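(* Let $n\geqslant 2$ and $n\leqslant q<\infty$. There exists a constant $C_n>0$ depending only on $n$ and $q$ such that the following holds. Let $Q:\mathbb{R}^n\to[0,\infty]$ be a Lebesgue measurable function with $Q\in L^1(\mathbb{R}^n)$, let $f\in\mathfrak{F}^q_Q(\mathbb{B}^n)$, where $\mathbb{B}^n$ is the open unit ball of $\mathbb{R}^n$, and let $K$ be a (nonempty) compact set in $\mathbb{B}^n$. Then for all $x,y\in K$ $$|f(x)-f(y)|\leqslant C_n\cdot\frac{(\Vert Q\Vert_1)^{\frac1q}}{\log^{\frac1n}\left(1+\frac{r_0}{2|x-y|}\right)},\qquad r_0=d(K,\partial\mathbb{B}^n),$$ where $\Vert Q\Vert_1$ is the $L^1$-norm of $Q$ in $\mathbb{R}^n$, $d$ is the Euclidean distance between sets, and the right-hand side is read as $0$ when $x=y$.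
   Context: Mappings are continuous. A continuum is a compact connected set with more than one point. $m$ denotes Lebesgue measure in $\mathbb{R}^n$, $\overline{\mathbb{R}^n}=\mathbb{R}^n\cup\{\infty\}$, $B(y_0,r)=\{y\in\mathbb{R}^n:|y-y_0|<r\}$, and $A(y_0,r_1,r_2)=\{y\in\mathbb{R}^n:r_1<|y-y_0|<r_2\}$. A mapping $f:D\to\mathbb{R}^n$ of a domain $D\subset\mathbb{R}^n$ is discrete if the preimage $f^{-1}(y)$ of each $y\in\mathbb{R}^n$ consists of isolated points, and open if the image of every open set $U\subset D$ is open in $\mathbb{R}^n$. For sets $E,F\subset\overline{\mathbb{R}^n}$ and a domain $D\subset\mathbb{R}^n$, $\Gamma(E,F,D)$ is the family of all paths $\gamma:[a,b]\to\overline{\mathbb{R}^n}$ with $\gamma(a)\in E$, $\gamma(b)\in F$ and $\gamma(t)\in D$ for all $t\in(a,b)$. For a family $\Gamma$ of paths, a Borel function $\rho:\mathbb{R}^n\to[0,\infty]$ is admissible for $\Gamma$ ($\rho\in\mathrm{adm}\,\Gamma$) if $\int_\gamma\rho(x)\,|dx|\geqslant1$ for all locally rectifiable $\gamma\in\Gamma$. For $q\geqslant 1$ the $q$-modulus of a family $\Gamma$ of paths in $D$ is $M_q(\Gamma)=\inf_{\rho\in\mathrm{adm}\,\Gamma}\int_D\rho^q(x)\,dm(x)$. For a domain $D\subset\mathbb{R}^n$, $1\leqslant q<\infty$ and a Lebesgue measurable $Q:\mathbb{R}^n\to[0,\infty]$, $\mathfrak{F}^q_Q(D)$ is the family of all open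 discrete mappings $f:D\to\mathbb{R}^n$ such that $$M_q(\Gamma(E,F,D))\leqslant\int_{A(y_0,r_1,r_2)\cap f(D)}Q(y)\cdot\eta^q(|y-y_0|)\,dm(y)$$ for every $y_0\in f(D)$, all $r_1,r_2$ with $0<r_1<r_2<\sup_{y\in f(D)}|y-y_0|$, all continua $E\subset f^{-1}(\overline{B(y_0,r_1)})$ and $F\subset f^{-1}(f(D)\setminus B(y_0,r_2))$, and every Lebesgue measurable function $\eta:(r_1,r_2)\to[0,\infty]$ with $\int_{r_1}^{r_2}\eta(r)\,dr\geqslant1$. *)

theory Defs
  imports "HOL-Analysis.Analysis"
begin

(* Only used for exponents q >= 1, so that infinity to the power q is infinity. *)
definition ennreal_powr :: "ennreal \<Rightarrow> real \<Rightarrow> ennreal" where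
  "ennreal_powr x q = (if x = \<infinity> then \<infinity> else ennreal (enn2real x powr q))"

definition curve_length :: "real \<Rightarrow> real \<Rightarrow> (real \<Rightarrow> 'a::euclidean_space) \<Rightarrow> ennreal" where
  "curve_length a b \<gamma> =
     (SUP (k, t) \<in> {(k::nat, t::nat \<Rightarrow> real). mono_on {..k} t \<and> t 0 = a \<and> t k = b}.
        \<Sum>i<k. ennreal (dist (\<gamma> (t i)) (\<gamma> (t (Suc i)))))"

definition locally_rectifiable :: "real \<Rightarrow> real \<Rightarrow> (real \<Rightarrow> 'a::euclidean_space) \<Rightarrow> bool" where
  "locally_rectifiable a b \<gamma> \<longleftrightarrow>
     (\<forall>c d. a \<le> c \<and> c \<le> d \<and> d \<le> b \<longrightarrow> curve_length c d \<gamma> < \<infinity>)"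

(* The normal representation (parametrization by arc length) of a rectifiable path on [a, b],
   used for 0 <= s <= length. The choice of t is immaterial, because a path is constant on
   every interval on which its length function is constant. *)
definition normal_rep :: "real \<Rightarrow> real \<Rightarrow> (real \<Rightarrow> 'a::euclidean_space) \<Rightarrow> real \<Rightarrow> 'a" where
  "normal_rep a b \<gamma> s = \<gamma> (SOME t. t \<in> {a..b} \<and> curve_length a t \<gamma> = ennreal s)"

(* The integral of rho with respect to arc length. It is used for locally rectifiable paths on
   the closed interval [a, b], which have finite length. *)
definition line_integral ::
    "('a::euclidean_space \<Rightarrow> ennreal) \<Rightarrow> real \<Rightarrow> real \<Rightarrow> (real \<Rightarrow> 'a) \<Rightarrow> ennreal" where
  "line_integral \<rho> a b \<gamma> =
     (\<integral>\<^sup>+ s \<in> {0..enn2real (curve_length a b \<gamma>)}. \<rho> (normal_rep a b \<gamma> s) \<partial>lebesgue)"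

(* A path is a triple (a, b, gamma); the values of gamma outside [a, b] are irrelevant. *)
type_synonym 'a curve = "real \<times> real \<times> (real \<Rightarrow> 'a)"

(* Gamma(E, F, D) for sets E and F of finite points. All values of such a path lie in the union
   of D, E and F, so the point at infinity cannot occur and paths in the one-point
   compactification are the same as paths in the Euclidean space itself. *)
definition joining_paths ::
    "'a::euclidean_space set \<Rightarrow> 'a set \<Rightarrow> 'a set \<Rightarrow> 'a curve set" where
  "joining_paths E F D =
     {(a, b, \<gamma>). a < b \<and> continuous_on {a..b} \<gamma> \<and> \<gamma> a \<in> E \<and> \<gamma> b \<in> F \<and> (\<forall>t\<in>{a<..<b}. \<gamma> t \<in> D)}"

definition admissible ::
    "'a::euclidean_space curve set \<Rightarrow> ('a \<Rightarrow> ennreal) set" where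
  "admissible \<Gamma> =
     {\<rho> \<in> borel_measurable borel.
        \<forall>(a, b, \<gamma>)\<in>\<Gamma>. locally_rectifiable a b \<gamma> \<longrightarrow> 1 \<le> line_integral \<rho> a b \<gamma>}"

definition path_modulus ::
    "real \<Rightarrow> 'a::euclidean_space set \<Rightarrow> 'a curve set \<Rightarrow> ennreal" where
  "path_modulus q D \<Gamma> =
     (INF \<rho> \<in> admissible \<Gamma>. \<integral>\<^sup>+ x \<in> D. ennreal_powr (\<rho> x) q \<partial>lebesgue)"

definition continuum :: "'a::euclidean_space set \<Rightarrow> bool" where
  "continuum E \<longleftrightarrow> compact E \<and> connected E \<and> (\<exists>x\<in>E. \<exists>y\<in>E. x \<noteq> y)"

definition annulus :: "'a::euclidean_space \<Rightarrow> real \<Rightarrow> real \<Rightarrow> 'a set" where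
  "annulus y\<^sub>0 r\<^sub>1 r\<^sub>2 = {y. r\<^sub>1 < norm (y - y\<^sub>0) \<and> norm (y - y\<^sub>0) < r\<^sub>2}"

definition open_mapping :: "'a::euclidean_space set \<Rightarrow> ('a \<Rightarrow> 'a) \<Rightarrow> bool" where
  "open_mapping D f \<longleftrightarrow> (\<forall>U. open U \<and> U \<subseteq> D \<longrightarrow> open (f ` U))"

definition discrete_mapping :: "'a::euclidean_space set \<Rightarrow> ('a \<Rightarrow> 'a) \<Rightarrow> bool" where
  "discrete_mapping D f \<longleftrightarrow> (\<forall>y. discrete {x \<in> D. f x = y})"

(* The class of open discrete mappings of the domain D satisfying the inverse Poletsky
   inequality with majorant Q. Only the values of f on D matter. *)
definition inverse_Poletsky ::
    "real \<Rightarrow> ('a::euclidean_space \<Rightarrow> ennreal) \<Rightarrow> 'a set \<Rightarrow> ('a \<Rightarrow> 'a) set" where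
  "inverse_Poletsky q Q D =
     {f. continuous_on D f \<and> open_mapping D f \<and> discrete_mapping D f \<and>
        (\<forall>y\<^sub>0 \<in> f ` D. \<forall>r\<^sub>1 r\<^sub>2. 0 < r\<^sub>1 \<and> r\<^sub>1 < r\<^sub>2 \<and> ereal r\<^sub>2 < (SUP y \<in> f ` D. ereal (norm (y - y\<^sub>0))) \<longrightarrow>
          (\<forall>E F. continuum E \<and> E \<subseteq> {x \<in> D. f x \<in> closure (ball y\<^sub>0 r\<^sub>1)} \<and>
                 continuum F \<and> F \<subseteq> {x \<in> D. f x \<in> f ` D - ball y\<^sub>0 r\<^sub>2} \<longrightarrow>
            (\<forall>\<eta> :: real \<Rightarrow> ennreal.
               \<eta> \<in> borel_measurable (lebesgue_on {r\<^sub>1<..<r\<^sub>2}) \<and>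
               1 \<le> (\<integral>\<^sup>+ r \<in> {r\<^sub>1<..<r\<^sub>2}. \<eta> r \<partial>lebesgue) \<longrightarrow>
               path_modulus q D (joining_paths E F D) \<le>
                 (\<integral>\<^sup>+ y \<in> annulus y\<^sub>0 r\<^sub>1 r\<^sub>2 \<inter> f ` D.
                    Q y * ennreal_powr (\<eta> (norm (y - y\<^sub>0))) q \<partial>lebesgue))))}"

(* The real-valued L1-norm, meaningful when the integral is finite. *)
definition L1_norm :: "('a::euclidean_space \<Rightarrow> ennreal) \<Rightarrow> real" where
  "L1_norm Q = enn2real (\<integral>\<^sup>+ y. Q y \<partial>lebesgue)"

end

(* Put y0 on the ray from f(x) pointing away from f(y), as the last point of the image of the component
   E of x in the preimage of that ray within a concentric ball; E reaches the boundary of the concentric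
   ball because f is open. Likewise F is found from the opposite ray at f(y). The spheres about y0
   through f(x) and f(y) have radii differing by |f(x) - f(y)|, so a constant eta bounds M_q(E, F)
   from above by ||Q||_1 / |f(x) - f(y)|^q.

   For the lower bound M_q >= c log^(q/n), each sphere |w - x| = t with |x - y| < t < R carries points
   of both continua. Joining them through every point z of a small ball by two segments and
   averaging in z bounds a weighted energy of rho over the ball of radius t from below; integrating
   dt/t gives the logarithm. This settles |x - y| <= (1 - |x|)/4. For distant points, moving towards
   the origin through geometrically growing distances from the sphere gives a bound logarithmic in
   |x - y|/r0, which is dominated by (|x - y|/r0)^(1/n). *)

theory Submission
  imports Defs
begin

section \<open>Preimages of rays\<close>

text \<open>The lower bound compares the exponents 1 and n, then n and q, by pointwise splitting at
  a threshold instead of Hoelder's inequality; each threshold is tuned so that the constant parts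
  together cost half of the left-hand side. The obstacle is that the exponent n is borderline for
  averages over segments. Splitting rho at a threshold proportional to s^(-b), with s the parameter
  measured from the end point on the sphere, leaves s^(-b), integrable only for b < 1, and after the
  change of variables from z to the point of the segment it leaves s^(b(n-1)-n), integrable only for
  b > 1. The weight \<open>shell_weight\<close>, at least 1/sqrt(2s) on the segment, creates the
  missing room. It costs only a constant: a point at distance r from the centre carries weight just
  for r < t <= 9r, and the weight is integrable there against dt/t. This is why the segments must
  stay t/9 away from the centre, and why z runs over a small ball placed on the side of both end
  points. The exponent 1/n of the theorem is the q-th root of log^(q/n).\<close>

lemma ray_component_meets_sphere:
  fixes f :: "'a::euclidean_space \<Rightarrow> 'a" and x v :: 'a
  assumes cont: "continuous_on D f" and opn: "open_mapping D f" and D: "cball 0 \<rho> \<subseteq> D"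
    and x: "x \<in> ball 0 \<rho>" and v: "norm v = 1"
  obtains C where "compact C" "connected C" "x \<in> C" "C \<subseteq> cball 0 \<rho>"
    "f ` C \<subseteq> (\<lambda>s. f x + s *\<^sub>R v) ` {0..}" "\<exists>z\<in>C. norm z = \<rho>"
proof -
  define R where "R = (\<lambda>s. f x + s *\<^sub>R v) ` {0..}"
  have v0: "v \<noteq> 0" using v by auto
  have "closed ((\<lambda>s. s *\<^sub>R v) ` {0::real..})"
    using v0 by (intro closed_injective_linear_image linear_scaleR_left) (auto intro: injI)
  then have "closed ((+) (f x) ` ((\<lambda>s. s *\<^sub>R v) ` {0::real..}))"
    by (rule closed_translation)
  then have clR: "closed R" by (simp add: R_def image_image)
  define A where "A = {u \<in> cball 0 \<rho>. f u \<in> R}"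
  have "closed A"
    unfolding A_def using continuous_closed_preimage[OF continuous_on_subset[OF cont D] closed_cball clR]
    by (simp add: vimage_def Int_def)
  then have compA: "compact A"
    by (metis A_def Int_absorb2 compact_Int_closed compact_cball inf_commute mem_Collect_eq subsetI)
  have xA: "x \<in> A" using x by (auto simp: A_def R_def intro!: image_eqI[of _ _ 0])
  define C where "C = connected_component_set A x"
  have CA: "C \<subseteq> A" by (simp add: C_def connected_component_subset)
  have CC: "C \<in> components A" using xA by (auto simp: C_def components_def)
  have compC: "compact C" using compA CC by (metis C_def compact_components)
  have xC: "x \<in> C" using xA by (simp add: C_def)
  have "\<exists>z\<in>C. norm z = \<rho>"
  proof (rule ccontr)
    assume neg: "\<not> ?thesis"
    have "C \<subseteq> ball 0 \<rho>" using CA neg by (force simp: A_def)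
    \<comment> \<open>A component of \<open>A\<close> inside the open ball has a compact
      neighbourhood \<open>K\<close>, relatively open in \<open>A\<close>, inside that ball. Hence
      \<open>K\<close> is the trace on \<open>A\<close> of an open set \<open>W\<close> of the
      domain, on which openness of \<open>f\<close> can be used.\<close>
    from Sura_Bura_clopen_subset[OF closed_imp_locally_compact[OF compact_imp_closed[OF compA]] CC compC open_ball this]
    obtain K where K: "openin (top_of_set A) K" "compact K" "C \<subseteq> K" "K \<subseteq> ball 0 \<rho>" by blast
    from K(1) obtain T where T: "open T" "K = A \<inter> T" by (auto simp: openin_open)
    define W where "W = T \<inter> ball 0 \<rho>"
    have W: "open W" "W \<subseteq> D" using T D ball_subset_cball by (auto simp: W_def)
    have openfW: "open (f ` W)" using opn W by (auto simp: open_mapping_def)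
    have KD: "K \<subseteq> D" using K(4) D ball_subset_cball by blast
    have "K \<noteq> {}" using K(3) xC by blast
    moreover have "continuous_on K (\<lambda>u. (f u - f x) \<bullet> v)"
      by (intro continuous_intros continuous_on_subset[OF cont KD])
    ultimately obtain u where u: "u \<in> K" "\<forall>w\<in>K. (f w - f x) \<bullet> v \<le> (f u - f x) \<bullet> v"
      using continuous_attains_sup[OF K(2)] by meson
    have "f u \<in> R" using u(1) T(2) by (simp add: A_def)
    then obtain s where s: "s \<ge> 0" "f u = f x + s *\<^sub>R v" by (auto simp: R_def)
    have "u \<in> W" using u(1) K(4) T(2) unfolding W_def by blast
    \<comment> \<open>The farthest image point of \<open>K\<close> along the ray can be pushed on by
      e/2: the new point of the ray has a preimage in \<open>W\<close>, which lies in
      \<open>A\<close> and so in \<open>K\<close>, against maximality of \<open>u\<close>.\<close>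
    then obtain e where e: "e > 0" "ball (f u) e \<subseteq> f ` W"
      using openfW unfolding open_contains_ball by blast
    have "f u + (e/2) *\<^sub>R v \<in> ball (f u) e" using e v by (simp add: dist_norm)
    then have "f u + (e/2) *\<^sub>R v \<in> f ` W" by (rule subsetD[OF e(2)])
    then obtain w where w: "f u + (e/2) *\<^sub>R v = f w" "w \<in> W" by (rule imageE)
    have fw: "f w = f x + (s + e/2) *\<^sub>R v"
      unfolding w(1)[symmetric] s(2) by (simp add: algebra_simps)
    have "s + e/2 \<in> {0..}" using s(1) e(1) by simp
    then have "f w \<in> R" unfolding R_def fw by (rule imageI)
    then have "w \<in> K" using w(2) T(2) unfolding W_def A_def by auto
    from u(2)[rule_format, OF this] have "(s + e/2) * (v \<bullet> v) \<le> s * (v \<bullet> v)"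
      by (simp add: fw s(2))
    then show False using e(1) v by (simp add: dot_square_norm)
  qed
  moreover have "connected C" by (simp add: C_def)
  moreover have "C \<subseteq> cball 0 \<rho>" "f ` C \<subseteq> R"
    using CA unfolding A_def by auto
  ultimately show thesis
    using compC xC unfolding R_def by (intro that[of C]) auto
qed

text \<open>Every point of a connected set with two points is a limit point. So no fibre of a
  discrete mapping contains a continuum.\<close>

lemma connected_two_points_not_discrete:
  fixes S :: "'a::metric_space set"
  assumes "connected S" "x \<in> S" "y \<in> S" "x \<noteq> y"
  shows "\<not> discrete S"
proof
  assume "discrete S"
  then have "x isolated_in S" using assms(2) by (rule discreteD)
  then have "\<not> x islimpt S" by (simp add: isolated_in_islimpt_iff)
  then show False using connected_imp_perfect[OF assms(1)] assms by blast
qed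

text \<open>The images lie on one line, in the order image of \<open>F\<close>, \<open>f y\<close>,
  \<open>f x\<close>, image of \<open>E\<close>. Seen from the far end \<open>y0\<close> of the
  image of \<open>E\<close>, the first image has distances at least r + eps and the last one at most
  r, where eps is the distance of \<open>f x\<close> and \<open>f y\<close>.\<close>

lemma continua_modulus_bound:
  fixes f :: "'a::euclidean_space \<Rightarrow> 'a" and x y :: 'a
  assumes f: "f \<in> inverse_Poletsky q Q (ball 0 1)" and Q: "Q \<in> borel_measurable lebesgue"
    and x: "x \<in> ball 0 \<rho>" and y: "y \<in> ball 0 \<rho>" and \<rho>: "\<rho> < 1" and ne: "f x \<noteq> f y"
  obtains E F where "continuum E" "continuum F" "x \<in> E" "y \<in> F"
    "E \<subseteq> ball 0 1" "F \<subseteq> ball 0 1"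
    "\<exists>z\<in>E. norm z = \<rho>" "\<exists>z\<in>F. norm z = \<rho>"
    "path_modulus q (ball 0 1) (joining_paths E F (ball 0 1)) \<le>
       ennreal (norm (f x - f y) powr (-q)) * (\<integral>\<^sup>+ y. Q y \<partial>lebesgue)"
proof -
  define D where "D = ball (0::'a) 1"
  have cont: "continuous_on D f" and opn: "open_mapping D f" and disc: "discrete_mapping D f"
    using f by (auto simp: inverse_Poletsky_def D_def)
  have cb: "cball 0 \<rho> \<subseteq> D" using \<rho> by (auto simp: D_def)
  define \<epsilon> where "\<epsilon> = norm (f x - f y)"
  have \<epsilon>: "\<epsilon> > 0" using ne by (simp add: \<epsilon>_def)
  define v where "v = (1/\<epsilon>) *\<^sub>R (f x - f y)"
  have v: "norm v = 1" using \<epsilon> ne by (simp add: v_def \<epsilon>_def)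
  have fy: "f y = f x - \<epsilon> *\<^sub>R v" using \<epsilon> by (simp add: v_def)
  obtain E where E: "compact E" "connected E" "x \<in> E" "E \<subseteq> cball 0 \<rho>"
      "f ` E \<subseteq> (\<lambda>s. f x + s *\<^sub>R v) ` {0..}" "\<exists>z\<in>E. norm z = \<rho>"
    by (rule ray_component_meets_sphere[OF cont opn cb x v])
  obtain F where F: "compact F" "connected F" "y \<in> F" "F \<subseteq> cball 0 \<rho>"
      "f ` F \<subseteq> (\<lambda>s. f y + s *\<^sub>R (-v)) ` {0..}" "\<exists>z\<in>F. norm z = \<rho>"
    by (rule ray_component_meets_sphere[OF cont opn cb y, of "-v"]) (simp add: v)
  have cE: "continuum E" 
    unfolding continuum_def using E(1,2,3,6) x by (metis mem_ball_0 less_irrefl)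
  have cF: "continuum F" 
    unfolding continuum_def using F(1,2,3,6) y by (metis mem_ball_0 less_irrefl)
  have ED: "E \<subseteq> D" and FD: "F \<subseteq> D" using E(4) F(4) cb by blast+
  have "continuous_on E (\<lambda>u. (f u - f x) \<bullet> v)"
    by (intro continuous_intros continuous_on_subset[OF cont ED])
  then obtain u where u: "u \<in> E" "\<And>w. w \<in> E \<Longrightarrow> (f w - f x) \<bullet> v \<le> (f u - f x) \<bullet> v"
    using continuous_attains_sup[OF E(1)] E(3) by blast
  have "f u \<in> (\<lambda>s. f x + s *\<^sub>R v) ` {0..}" using E(5) u(1) by blast
  then obtain r where r: "r \<ge> 0" "f u = f x + r *\<^sub>R v" by auto
  have vv: "v \<bullet> v = 1" using v by (simp add: dot_square_norm)
  have fE: "\<exists>s. 0 \<le> s \<and> s \<le> r \<and> f w = f x + s *\<^sub>R v" if "w \<in> E" for w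
  proof -
    have "f w \<in> (\<lambda>s. f x + s *\<^sub>R v) ` {0..}" using E(5) that by blast
    then obtain s where s: "0 \<le> s" "f w = f x + s *\<^sub>R v" by auto
    have "s \<le> r" using u(2)[OF that] by (simp add: r(2) s(2) vv)
    then show ?thesis using s by blast
  qed
  \<comment> \<open>The inner radius has to be positive. If r were 0, then \<open>f\<close> would be
    constant on the continuum \<open>E\<close>, which discreteness forbids.\<close>
  have "r > 0"
  proof (rule ccontr)
    assume "\<not> 0 < r"
    then have fc: "f w = f x" if "w \<in> E" for w using fE[OF that] r by auto
    have "E \<subseteq> {u \<in> D. f u = f x}" using fc ED by auto
    then have "discrete E" using disc by (metis discrete_mapping_def discrete_subset)
    then show False using cE connected_two_points_not_discrete by (metis continuum_def)
  qed
  define y0 where "y0 = f u"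
  have y0: "y0 = f x + r *\<^sub>R v" using r by (simp add: y0_def)
  have Esub: "E \<subseteq> {x \<in> D. f x \<in> closure (ball y0 r)}"
  proof safe
    fix w assume w: "w \<in> E"
    then show "w \<in> D" using ED by auto
    obtain s where "0 \<le> s" "s \<le> r" "f w = f x + s *\<^sub>R v" using fE[OF w] by auto
    then have "dist y0 (f w) = norm ((r - s) *\<^sub>R v)" by (simp add: y0 dist_norm algebra_simps)
    also have "\<dots> \<le> r" using v \<open>0 \<le> s\<close> \<open>s \<le> r\<close> by simp
    finally show "f w \<in> closure (ball y0 r)" using \<open>r > 0\<close> by simp
  qed
  have Fsub: "F \<subseteq> {x \<in> D. f x \<in> f ` D - ball y0 (r+\<epsilon>)}"
  proof
    fix w assume w: "w \<in> F"
    then have wD: "w \<in> D" using FD by auto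
    have "f w \<in> (\<lambda>s. f y + s *\<^sub>R (-v)) ` {0..}" using F(5) w by blast
    then obtain s where s: "0 \<le> s" "f w = f y + s *\<^sub>R (-v)" by auto
    have "dist y0 (f w) = norm ((r + \<epsilon> + s) *\<^sub>R v)"
      unfolding s(2) y0 fy dist_norm by (simp add: algebra_simps)
    then have "r + \<epsilon> \<le> dist y0 (f w)" using v s(1) r(1) \<epsilon> by simp
    then show "w \<in> {x \<in> D. f x \<in> f ` D - ball y0 (r+\<epsilon>)}" using wD by auto
  qed
  \<comment> \<open>The outer radius must lie strictly below the supremum of the distances to
    \<open>y0\<close>. Since the image is open, it contains a point slightly beyond
    \<open>f y\<close>, at distance r + eps + e/2.\<close>
  have "open (f ` D)" using opn by (auto simp: open_mapping_def D_def)
  moreover have "f y \<in> f ` D" using F(3) FD by blast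
  ultimately obtain e where e: "e > 0" "ball (f y) e \<subseteq> f ` D"
    unfolding open_contains_ball by blast
  have "f y - (e/2) *\<^sub>R v \<in> f ` D" using e v by (intro subsetD[OF e(2)]) (simp add: dist_norm)
  then have "ereal (norm (f y - (e/2) *\<^sub>R v - y0)) \<le> (SUP y \<in> f ` D. ereal (norm (y - y0)))"
    by (rule SUP_upper)
  moreover have "norm (f y - (e/2) *\<^sub>R v - y0) = r + \<epsilon> + e/2"
  proof -
    have "f y - (e/2) *\<^sub>R v - y0 = - ((r + \<epsilon> + e/2) *\<^sub>R v)" by (simp add: y0 fy algebra_simps)
    then show ?thesis using v r \<epsilon> e by (simp only: norm_minus_cancel norm_scaleR) simp
  qed
  ultimately have sup: "ereal (r + \<epsilon>) < (SUP y \<in> f ` D. ereal (norm (y - y0)))"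
    using e(1) less_le_trans[of "ereal (r + \<epsilon>)" "ereal (r + \<epsilon> + e/2)"] by simp
  define \<eta> where "\<eta> = (\<lambda>r::real. ennreal (1/\<epsilon>))"
  have "(\<integral>\<^sup>+ s \<in> {r<..<r+\<epsilon>}. \<eta> s \<partial>lebesgue) = ennreal (1/\<epsilon>) * emeasure lebesgue {r<..<r+\<epsilon>}"
    unfolding \<eta>_def by (subst nn_integral_cmult_indicator) auto
  also have "\<dots> = 1" using \<epsilon> by (simp add: ennreal_mult[symmetric])
  finally have int\<eta>: "1 \<le> (\<integral>\<^sup>+ s \<in> {r<..<r+\<epsilon>}. \<eta> s \<partial>lebesgue)" by simp
  have \<eta>m: "\<eta> \<in> borel_measurable (lebesgue_on {r<..<r+\<epsilon>})" by (simp add: \<eta>_def)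
  have y0D: "y0 \<in> f ` D" using u ED by (auto simp: y0_def)
  have *: "\<forall>y\<^sub>0 \<in> f ` D. \<forall>r\<^sub>1 r\<^sub>2. 0 < r\<^sub>1 \<and> r\<^sub>1 < r\<^sub>2 \<and> ereal r\<^sub>2 < (SUP y \<in> f ` D. ereal (norm (y - y\<^sub>0))) \<longrightarrow>
          (\<forall>E F. continuum E \<and> E \<subseteq> {x \<in> D. f x \<in> closure (ball y\<^sub>0 r\<^sub>1)} \<and>
                 continuum F \<and> F \<subseteq> {x \<in> D. f x \<in> f ` D - ball y\<^sub>0 r\<^sub>2} \<longrightarrow>
            (\<forall>\<eta> :: real \<Rightarrow> ennreal.
               \<eta> \<in> borel_measurable (lebesgue_on {r\<^sub>1<..<r\<^sub>2}) \<and>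
               1 \<le> (\<integral>\<^sup>+ r \<in> {r\<^sub>1<..<r\<^sub>2}. \<eta> r \<partial>lebesgue) \<longrightarrow>
               path_modulus q D (joining_paths E F D) \<le>
                 (\<integral>\<^sup>+ y \<in> annulus y\<^sub>0 r\<^sub>1 r\<^sub>2 \<inter> f ` D.
                    Q y * ennreal_powr (\<eta> (norm (y - y\<^sub>0))) q \<partial>lebesgue)))"
    using f unfolding inverse_Poletsky_def D_def by blast
  have "path_modulus q D (joining_paths E F D) \<le>
    (\<integral>\<^sup>+ y \<in> annulus y0 r (r+\<epsilon>) \<inter> f ` D. Q y * ennreal_powr (\<eta> (norm (y - y0))) q \<partial>lebesgue)"
    by (intro *[rule_format] conjI y0D \<open>r > 0\<close> sup cE cF Esub Fsub \<eta>m int\<eta>) (simp add: \<epsilon>)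
  also have "\<dots> \<le> (\<integral>\<^sup>+ y. ennreal (\<epsilon> powr (-q)) * Q y \<partial>lebesgue)"
    using \<epsilon> by (intro nn_integral_mono)
      (auto simp: \<eta>_def ennreal_powr_def indicator_def powr_divide powr_minus divide_simps mult.commute)
  also have "\<dots> \<le> ennreal (\<epsilon> powr (-q)) * (\<integral>\<^sup>+ y. Q y \<partial>lebesgue)"
    using Q by (subst nn_integral_cmult) auto
  finally show thesis
    using cE cF E(3,6) F(3,6) ED FD unfolding D_def \<epsilon>_def by (intro that[of E F]) auto
qed

section \<open>Line integrals along two segments\<close>

lemma curve_length_le_of_nonexpansive:
  fixes \<gamma> :: "real \<Rightarrow> 'a::euclidean_space"
  assumes lip: "\<And>s t. a \<le> s \<Longrightarrow> s \<le> t \<Longrightarrow> t \<le> b \<Longrightarrow> dist (\<gamma> s) (\<gamma> t) \<le> t - s"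
  shows "curve_length a b \<gamma> \<le> ennreal (b - a)"
  unfolding curve_length_def
proof (rule SUP_least, clarify)
  fix k :: nat and \<tau> :: "nat \<Rightarrow> real"
  assume mono: "mono_on {..k} \<tau>" and a: "a = \<tau> 0" and b: "b = \<tau> k"
  have "(\<Sum>i<k. ennreal (dist (\<gamma> (\<tau> i)) (\<gamma> (\<tau> (Suc i))))) \<le> (\<Sum>i<k. ennreal (\<tau> (Suc i) - \<tau> i))"
    using mono by (intro sum_mono ennreal_leI lip) (auto simp: a b mono_on_def)
  also have "\<dots> = ennreal (\<Sum>i<k. \<tau> (Suc i) - \<tau> i)"
    using mono by (intro sum_ennreal) (auto simp: mono_on_def)
  also have "(\<Sum>i<k. \<tau> (Suc i) - \<tau> i) = \<tau> k - \<tau> 0"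
    by (rule sum_lessThan_telescope)
  finally show "(\<Sum>i<k. ennreal (dist (\<gamma> (\<tau> i)) (\<gamma> (\<tau> (Suc i))))) \<le> ennreal (\<tau> k - \<tau> 0)" .
qed

lemma curve_length_ge_dist_add:
  fixes \<gamma> :: "real \<Rightarrow> 'a::euclidean_space"
  assumes "a \<le> m" "m \<le> b"
  shows "ennreal (dist (\<gamma> a) (\<gamma> m) + dist (\<gamma> m) (\<gamma> b)) \<le> curve_length a b \<gamma>"
proof -
  define \<tau> where "\<tau> = (\<lambda>i::nat. if i = 0 then a else if i = 1 then m else b)"
  have "ennreal (dist (\<gamma> a) (\<gamma> m) + dist (\<gamma> m) (\<gamma> b)) =
      (\<Sum>i<2. ennreal (dist (\<gamma> (\<tau> i)) (\<gamma> (\<tau> (Suc i)))))"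
    by (simp add: \<tau>_def numeral_2_eq_2)
  also have "\<dots> \<le> curve_length a b \<gamma>"
    unfolding curve_length_def
    using assms by (intro SUP_upper2[where i="(2, \<tau>)"]) (auto simp: \<tau>_def mono_on_def)
  finally show ?thesis .
qed

text \<open>If arc length from 0 equals the parameter, the choice in \<open>normal_rep\<close> has a
  single candidate, and the abstract line integral becomes a plain one.\<close>

lemma line_integral_arclength_param:
  assumes b: "0 \<le> b" and len: "\<And>t. 0 \<le> t \<Longrightarrow> t \<le> b \<Longrightarrow> curve_length 0 t \<gamma> = ennreal t"
  shows "line_integral \<rho> 0 b \<gamma> = (\<integral>\<^sup>+ s \<in> {0..b}. \<rho> (\<gamma> s) \<partial>lebesgue)"
proof -
  have "normal_rep 0 b \<gamma> s = \<gamma> s" if "s \<in> {0..b}" for s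
  proof -
    have "(SOME t. t \<in> {0..b} \<and> curve_length 0 t \<gamma> = ennreal s) = s"
      by (rule some_equality) (use that len in auto)
    then show ?thesis by (simp add: normal_rep_def)
  qed
  then show ?thesis
    unfolding line_integral_def using b len[of b]
    by (intro nn_integral_cong) (auto simp: indicator_def)
qed

text \<open>The arc-length integral over a segment in affine parametrisation. The first argument,
  reached at s = 0, will be the point on the sphere, so that the singular behaviour of the averages
  sits at s = 0 for both halves of a path.\<close>

definition segment_integral :: "('a::euclidean_space \<Rightarrow> ennreal) \<Rightarrow> 'a \<Rightarrow> 'a \<Rightarrow> ennreal" where
  "segment_integral \<rho> a b =
     ennreal (dist a b) * (\<integral>\<^sup>+ s \<in> {0..1}. \<rho> (a + s *\<^sub>R (b - a)) \<partial>lborel)"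

text \<open>The segments are traversed at unit speed from \<open>e\<close> through \<open>z\<close>
  to \<open>g\<close>. The path is then nonexpansive, which bounds its length above, and the
  partition with the corner as its only inner point gives the same bound below; so arc length is the
  parameter.\<close>

lemma two_segment_path:
  fixes e z g :: "'a::euclidean_space"
  assumes \<rho>[measurable]: "\<rho> \<in> borel_measurable borel" and "e \<noteq> z" "z \<noteq> g"
  obtains b \<gamma> where "0 < b" "continuous_on {0..b} \<gamma>" "\<gamma> 0 = e" "\<gamma> b = g"
    "\<gamma> ` {0..b} \<subseteq> closed_segment e z \<union> closed_segment z g"
    "locally_rectifiable 0 b \<gamma>"
    "line_integral \<rho> 0 b \<gamma> \<le> segment_integral \<rho> e z + segment_integral \<rho> g z"
proof -
  define l m where "l = dist e z" and "m = dist z g"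
  have lm: "l > 0" "m > 0" using assms by (auto simp: l_def m_def)
  define \<alpha> where "\<alpha> = (\<lambda>s. e + (s / l) *\<^sub>R (z - e))"
  define \<beta> where "\<beta> = (\<lambda>s. z + ((s - l) / m) *\<^sub>R (g - z))"
  define \<gamma> where "\<gamma> = (\<lambda>s. if s \<le> l then \<alpha> s else \<beta> s)"
  have \<alpha>: "dist (\<alpha> s) (\<alpha> t) = \<bar>t - s\<bar>" for s t
  proof -
    have "\<alpha> s - \<alpha> t = ((s - t) / l) *\<^sub>R (z - e)" by (simp add: \<alpha>_def algebra_simps diff_divide_distrib)
    then have "norm (\<alpha> s - \<alpha> t) = \<bar>s - t\<bar> / l * norm (z - e)" using lm by simp
    also have "\<dots> = \<bar>s - t\<bar>" using lm by (simp add: l_def dist_norm norm_minus_commute)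
    finally show ?thesis by (simp add: dist_norm abs_minus_commute)
  qed
  have \<beta>: "dist (\<beta> s) (\<beta> t) = \<bar>t - s\<bar>" for s t
  proof -
    have "\<beta> s - \<beta> t = ((s - t) / m) *\<^sub>R (g - z)" by (simp add: \<beta>_def algebra_simps diff_divide_distrib)
    then have "norm (\<beta> s - \<beta> t) = \<bar>s - t\<bar> / m * norm (g - z)" using lm by simp
    also have "\<dots> = \<bar>s - t\<bar>" using lm by (simp add: m_def dist_norm norm_minus_commute)
    finally show ?thesis by (simp add: dist_norm abs_minus_commute)
  qed
  have \<alpha>l: "\<alpha> l = z" "\<alpha> 0 = e" using lm by (auto simp: \<alpha>_def)
  have \<beta>l: "\<beta> l = z" "\<beta> (l + m) = g" using lm by (auto simp: \<beta>_def)
  have lip: "dist (\<gamma> s) (\<gamma> t) \<le> t - s" if "s \<le> t" for s t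
  proof -
    consider "t \<le> l" | "l < s" | "s \<le> l" "l < t" using that by linarith
    then show ?thesis
    proof cases
      case 3
      have "dist (\<alpha> s) (\<beta> t) \<le> dist (\<alpha> s) (\<alpha> l) + dist (\<beta> l) (\<beta> t)"
        using dist_triangle[of "\<alpha> s" "\<beta> t" z] by (simp add: \<alpha>l \<beta>l)
      also have "\<dots> = t - s" using 3 by (simp only: \<alpha> \<beta>)
      finally show ?thesis using 3 by (simp add: \<gamma>_def)
    qed (use that \<alpha>[of s t] \<beta>[of s t] in \<open>auto simp: \<gamma>_def\<close>)
  qed
  have len: "curve_length 0 t \<gamma> = ennreal t" if t: "0 \<le> t" for t
  proof (rule antisym)
    show "curve_length 0 t \<gamma> \<le> ennreal t"
      using curve_length_le_of_nonexpansive[of 0 t \<gamma>] lip by simp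
    have "t = dist (\<gamma> 0) (\<gamma> (min l t)) + dist (\<gamma> (min l t)) (\<gamma> t)"
    proof (cases "t \<le> l")
      case True
      then show ?thesis using t lm \<alpha>[of 0 t] by (simp add: \<gamma>_def)
    next
      case False
      then have "\<gamma> (min l t) = z" using \<alpha>l by (simp add: \<gamma>_def)
      moreover have "dist (\<gamma> 0) z = l" using \<alpha>[of 0 l] lm by (simp add: \<gamma>_def \<alpha>l)
      moreover have "dist z (\<gamma> t) = t - l" using \<beta>[of l t] False by (simp add: \<gamma>_def \<beta>l)
      ultimately show ?thesis by simp
    qed
    then show "ennreal t \<le> curve_length 0 t \<gamma>"
      using curve_length_ge_dist_add[of 0 "min l t" t \<gamma>] t lm by simp
  qed
  have rect: "locally_rectifiable 0 (l + m) \<gamma>"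
    unfolding locally_rectifiable_def
  proof (intro allI impI)
    fix c d assume "0 \<le> c \<and> c \<le> d \<and> d \<le> l + m"
    then have "curve_length c d \<gamma> \<le> ennreal (d - c)"
      using lip by (intro curve_length_le_of_nonexpansive) auto
    then show "curve_length c d \<gamma> < \<infinity>" by (simp add: le_less_trans)
  qed
  have "1-lipschitz_on {0..l+m} \<gamma>"
  proof (rule lipschitz_onI)
    fix s t show "dist (\<gamma> s) (\<gamma> t) \<le> 1 * dist s t"
      using lip[of s t] lip[of t s] by (cases "s \<le> t") (auto simp: dist_real_def dist_commute)
  qed simp
  then have cont: "continuous_on {0..l+m} \<gamma>" by (rule lipschitz_on_continuous_on)
  have img: "\<gamma> ` {0..l+m} \<subseteq> closed_segment e z \<union> closed_segment z g"
  proof (rule image_subsetI)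
    fix s assume s: "s \<in> {0..l+m}"
    show "\<gamma> s \<in> closed_segment e z \<union> closed_segment z g"
    proof (cases "s \<le> l")
      case True
      then show ?thesis using s lm
        by (intro UnI1) (auto simp: in_segment \<gamma>_def \<alpha>_def algebra_simps intro!: exI[of _ "s/l"])
    next
      case False
      then show ?thesis using s lm
        by (intro UnI2) (auto simp: in_segment \<gamma>_def \<beta>_def algebra_simps intro!: exI[of _ "(s-l)/m"])
    qed
  qed
  have "line_integral \<rho> 0 (l+m) \<gamma> = (\<integral>\<^sup>+ s \<in> {0..l+m}. \<rho> (\<gamma> s) \<partial>lborel)"
    using line_integral_arclength_param[of "l+m" \<gamma> \<rho>] len lm by (simp add: nn_integral_completion)
  also have "\<dots> \<le> (\<integral>\<^sup>+ s. \<rho> (\<alpha> s) * indicator {0..l} s + \<rho> (\<beta> s) * indicator {l..l+m} s \<partial>lborel)"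
    by (intro nn_integral_mono) (auto simp: indicator_def \<gamma>_def)
  also have "\<dots> = (\<integral>\<^sup>+ s. \<rho> (\<alpha> s) * indicator {0..l} s \<partial>lborel) + (\<integral>\<^sup>+ s. \<rho> (\<beta> s) * indicator {l..l+m} s \<partial>lborel)"
    unfolding \<alpha>_def \<beta>_def by (intro nn_integral_add) measurable
  also have "(\<integral>\<^sup>+ s. \<rho> (\<alpha> s) * indicator {0..l} s \<partial>lborel) = segment_integral \<rho> e z"
  proof -
    have "(\<integral>\<^sup>+ s. \<rho> (\<alpha> s) * indicator {0..l} s \<partial>lborel) =
        ennreal \<bar>l\<bar> * (\<integral>\<^sup>+ s. \<rho> (\<alpha> (0 + l * s)) * indicator {0..l} (0 + l * s) \<partial>lborel)"
      unfolding \<alpha>_def by (rule nn_integral_real_affine) (use lm in auto)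
    also have "(\<lambda>s. \<rho> (\<alpha> (0 + l * s)) * indicator {0..l} (0 + l * s)) =
       (\<lambda>s. \<rho> (e + s *\<^sub>R (z - e)) * indicator {0..1} s)"
      using lm by (auto simp: \<alpha>_def indicator_def fun_eq_iff zero_le_mult_iff)
    finally show ?thesis using lm by (simp add: segment_integral_def l_def)
  qed
  also have "(\<integral>\<^sup>+ s. \<rho> (\<beta> s) * indicator {l..l+m} s \<partial>lborel) = segment_integral \<rho> g z"
  proof -
    \<comment> \<open>The negative factor \<open>-m\<close> reverses the second half, so that it too
      starts at its end point \<open>g\<close> on the sphere.\<close>
    have "(\<integral>\<^sup>+ s. \<rho> (\<beta> s) * indicator {l..l+m} s \<partial>lborel) =
        ennreal \<bar>-m\<bar> * (\<integral>\<^sup>+ s. \<rho> (\<beta> ((l + m) + (-m) * s)) * indicator {l..l+m} ((l + m) + (-m) * s) \<partial>lborel)"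
      unfolding \<beta>_def by (rule nn_integral_real_affine) (use lm in auto)
    also have "(\<lambda>s. \<rho> (\<beta> ((l + m) + (-m) * s)) * indicator {l..l+m} ((l + m) + (-m) * s)) =
       (\<lambda>s. \<rho> (g + s *\<^sub>R (z - g)) * indicator {0..1} s)"
    proof
      fix s
      have *: "((l + m) + (-m) * s - l) / m = 1 - s" using lm by (simp add: field_simps)
      have "\<beta> ((l + m) + (-m) * s) = g + s *\<^sub>R (z - g)"
        unfolding \<beta>_def * by (simp add: algebra_simps)
      moreover have "((l + m) + (-m) * s \<in> {l..l+m}) = (s \<in> {0..1})"
        using lm by (auto simp: zero_le_mult_iff)
      ultimately show "\<rho> (\<beta> ((l + m) + (-m) * s)) * indicator {l..l+m} ((l + m) + (-m) * s) =
         \<rho> (g + s *\<^sub>R (z - g)) * indicator {0..1} s"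
        by (simp add: indicator_def)
    qed
    finally show ?thesis using lm by (simp add: segment_integral_def m_def dist_commute)
  qed
  finally show thesis
    using lm cont rect img \<alpha>l \<beta>l by (intro that[of "l+m" \<gamma>]) (auto simp: \<gamma>_def)
qed

section \<open>Averages over segments\<close>

lemma nn_integral_lborel_affine:
  fixes f :: "'a::euclidean_space \<Rightarrow> ennreal"
  assumes [measurable]: "f \<in> borel_measurable borel" and c: "0 < c"
  shows "(\<integral>\<^sup>+ x. f x \<partial>lborel) = ennreal (c ^ DIM('a)) * (\<integral>\<^sup>+ x. f (t + c *\<^sub>R x) \<partial>lborel)"
proof -
  have "(\<integral>\<^sup>+ x. f x \<partial>lborel) =
      (\<integral>\<^sup>+ x. f x \<partial>density (distr lborel borel (\<lambda>x. t + c *\<^sub>R x)) (\<lambda>_. \<bar>c\<bar>^DIM('a)))"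
    using c by (intro arg_cong[where f="\<lambda>M. nn_integral M f"] lborel_affine) simp
  also have "\<dots> = (\<integral>\<^sup>+ x. ennreal (\<bar>c\<bar>^DIM('a)) * f x \<partial>distr lborel borel (\<lambda>x. t + c *\<^sub>R x))"
    by (rule nn_integral_density) measurable
  also have "\<dots> = (\<integral>\<^sup>+ x. ennreal (\<bar>c\<bar>^DIM('a)) * f (t + c *\<^sub>R x) \<partial>lborel)"
    by (rule nn_integral_distr) measurable
  also have "\<dots> = ennreal (\<bar>c\<bar>^DIM('a)) * (\<integral>\<^sup>+ x. f (t + c *\<^sub>R x) \<partial>lborel)"
    by (rule nn_integral_cmult) measurable
  finally show ?thesis using c by simp
qed

lemma nn_integral_powr_unit_interval:
  assumes "-1 < a"
  shows "(\<integral>\<^sup>+ s \<in> {0..1}. ennreal (s powr a) \<partial>lborel) = ennreal (1 / (a + 1))"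
proof -
  have "((\<lambda>s. s powr a) has_integral 1 / (a+1)) {0..1}"
    using has_integral_powr_from_0[OF assms, of 1] by simp
  from nn_integral_has_integral_lebesgue[OF _ this]
  have "(\<integral>\<^sup>+ s. ennreal (indicator {0..1} s * s powr a) \<partial>lborel) = ennreal (1 / (a+1))"
    by simp
  also have "(\<lambda>s. ennreal (indicator {0..1} s * s powr a)) = (\<lambda>s. ennreal (s powr a) * indicator {0..1} s)"
    by (auto simp: indicator_def fun_eq_iff)
  finally show ?thesis .
qed

text \<open>Either x <= 1/c, or c x >= 1 and then x <= x (c x)^(n-1). The free \<open>c\<close> will
  depend on the position along a segment.\<close>

lemma ennreal_le_add_power:
  fixes x :: ennreal
  assumes c: "0 < c" and n: "n \<ge> 1"
  shows "x \<le> ennreal (1 / c) + ennreal (c ^ (n - 1)) * x ^ n"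
proof (cases x)
  case (real r)
  show ?thesis
  proof (cases "r \<le> 1 / c")
    case True
    then have "x \<le> ennreal (1/c)" using real by (simp add: ennreal_leI)
    then show ?thesis by (rule order_trans) simp
  next
    case False
    then have "1 \<le> c * r" using c by (simp add: field_simps)
    then have "r * 1 \<le> r * (c * r) ^ (n - 1)" using real by (intro mult_left_mono one_le_power) auto
    also have "\<dots> = c ^ (n - 1) * r ^ n"
      using n by (simp add: power_mult_distrib mult_ac power_eq_if[of r n])
    finally have "x \<le> ennreal (c ^ (n - 1)) * x ^ n"
      using real c by (simp add: ennreal_power ennreal_mult[symmetric] ennreal_leI)
    then show ?thesis by (rule order_trans) simp
  qed
next
  case top
  then show ?thesis using assms by (simp add: ennreal_mult_top top_power_ennreal)
qed

text \<open>The square root, singular at the sphere of radius \<^term>\<open>t\<close>, is a substitute for a power of the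
  distance from the end point of a segment on that sphere. It depends on the end point only through
  \<^term>\<open>t\<close>, so that the end points need not be chosen measurably in \<^term>\<open>t\<close>.\<close>

definition shell_weight :: "'a::euclidean_space \<Rightarrow> real \<Rightarrow> 'a \<Rightarrow> real" where
  "shell_weight p t w = (if t / 9 \<le> dist p w \<and> dist p w < t then sqrt (t / (t - dist p w)) else 0)"

lemma shell_weight_nonneg [simp]: "0 < t \<Longrightarrow> 0 \<le> shell_weight p t w"
  by (simp add: shell_weight_def)

lemma borel_measurable_shell_weight [measurable]:
  "(\<lambda>(t, w). shell_weight p t w) \<in> borel_measurable (borel \<Otimes>\<^sub>M borel)"
  unfolding shell_weight_def case_prod_beta by measurable

lemma borel_measurable_shell_weight1 [measurable]:
  "shell_weight p t \<in> borel_measurable borel"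
  unfolding shell_weight_def by measurable

text \<open>The splitting lemma is applied with threshold 1/\<open>L\<close>, where \<open>L\<close>
  = M t s^(1-a). The exponent a = 1/(2n) makes (1-a)(n-1) + 1/2 = (a-1) + n, the 1/2 being gained
  from the weight. So both terms carry the same integrable power s^(a-1), and the remaining s^n is
  the Jacobian of z |-> e + s(z - e).\<close>

lemma segment_integrand_bound:
  fixes \<rho> :: "'a::euclidean_space \<Rightarrow> ennreal" and p e z :: 'a
  defines "n \<equiv> DIM('a)"
  defines "a \<equiv> 1 / (2 * real n)"
  assumes t: "0 < t" and e: "dist p e = t" and z: "dist p z < t" and s: "0 < s" "s \<le> 1" and M: "0 < M"
  defines "w \<equiv> e + s *\<^sub>R (z - e)"
  assumes far: "t / 9 \<le> dist p w"
  shows "ennreal (dist e z) * \<rho> w \<le> ennreal (2 / M * s powr (a - 1)) +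
     ennreal (2 * sqrt 2 * M ^ (n - 1) * t ^ n * s powr (a - 1) * s ^ n) *
       (\<rho> w ^ n * ennreal (shell_weight p t w))"
proof -
  have n: "n \<ge> 1" by (simp add: n_def Suc_leI)
  have ez: "dist e z \<le> 2 * t" using e z dist_triangle[of e z p] by (simp add: dist_commute)
  have we: "dist w e = s * dist e z" using s by (simp add: w_def dist_norm norm_minus_commute)
  have wt: "dist p w < t"
  proof -
    have "p - w = (1 - s) *\<^sub>R (p - e) + s *\<^sub>R (p - z)" by (simp add: w_def algebra_simps)
    then have "dist p w \<le> (1 - s) * t + s * dist p z"
      using s norm_triangle_ineq[of "(1 - s) *\<^sub>R (p - e)" "s *\<^sub>R (p - z)"] e
      by (simp add: dist_norm)
    also have "\<dots> < (1 - s) * t + s * t" using s z by simp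
    finally show ?thesis by (simp add: algebra_simps)
  qed
  \<comment> \<open>The gap between \<open>w\<close> and the sphere is at most its distance to
    \<open>e\<close>, which is at most 2ts. This yields the lower bound 1/sqrt(2s) for the
    weight.\<close>
  have "t - dist p w \<le> s * (2 * t)"
    using dist_triangle[of p e w] e we mult_left_mono[OF ez less_imp_le[OF s(1)]] by linarith
  then have "1 \<le> 2 * s * (t / (t - dist p w))" using wt by (simp add: field_simps)
  then have "1 \<le> sqrt (2 * s * (t / (t - dist p w)))" by simp
  then have "1 \<le> sqrt 2 * sqrt s * sqrt (t / (t - dist p w))" by (simp only: real_sqrt_mult)
  then have wgt: "1 \<le> sqrt 2 * s powr (1/2) * shell_weight p t w"
    using far wt s by (simp add: shell_weight_def powr_half_sqrt)
  define L where "L = M * t * s powr (1 - a)"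
  have L: "L > 0" using M t s by (simp add: L_def)
  have e1: "2 * t * (1 / L) = 2 / M * s powr (a - 1)"
    using M t s by (simp add: L_def powr_diff field_simps)
  have "a * (real n - 1) = 1/2 - a" using n by (simp add: a_def field_simps)
  then have ex: "(1 - a) * real (n - 1) + 1/2 = (a - 1) + real n"
    using n by (simp add: of_nat_diff algebra_simps)
  have "(s powr (1 - a)) ^ (n - 1) * s powr (1/2) = s powr ((1 - a) * real (n - 1)) * s powr (1/2)"
    using s by (simp add: powr_powr[symmetric] powr_realpow)
  also have "\<dots> = s powr (a - 1) * s ^ n"
    unfolding powr_add[symmetric] ex using s by (simp add: powr_add powr_realpow)
  finally have e2': "(s powr (1 - a)) ^ (n - 1) * s powr (1/2) = s powr (a - 1) * s ^ n" .
  have "2 * t * L ^ (n - 1) * (sqrt 2 * s powr (1/2)) =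
      2 * sqrt 2 * M ^ (n - 1) * (t * t ^ (n - 1)) * ((s powr (1 - a)) ^ (n - 1) * s powr (1/2))"
    by (simp add: L_def power_mult_distrib mult_ac)
  also have "\<dots> = 2 * sqrt 2 * M ^ (n - 1) * t ^ n * (s powr (a - 1) * s ^ n)"
    unfolding e2' using n by (simp add: power_eq_if[of t n])
  finally have e2: "2 * t * L ^ (n - 1) * (sqrt 2 * s powr (1/2)) =
      2 * sqrt 2 * M ^ (n - 1) * t ^ n * s powr (a - 1) * s ^ n" by (simp add: mult_ac)
  have "ennreal (dist e z) * \<rho> w \<le> ennreal (2 * t) * (ennreal (1 / L) + ennreal (L ^ (n - 1)) * \<rho> w ^ n)"
    by (intro mult_mono ennreal_leI ez ennreal_le_add_power L n) auto
  also have "\<dots> = ennreal (2 / M * s powr (a - 1)) + ennreal (2 * t * L ^ (n - 1)) * (\<rho> w ^ n * 1)"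
  proof -
    have "ennreal (2 * t) * ennreal (1 / L) = ennreal (2 / M * s powr (a - 1))"
      unfolding e1[symmetric] using L t by (intro ennreal_mult[symmetric]) auto
    moreover have "ennreal (2 * t) * ennreal (L ^ (n - 1)) = ennreal (2 * t * L ^ (n - 1))"
      using L t by (intro ennreal_mult[symmetric]) auto
    ultimately show ?thesis by (simp add: distrib_left mult.assoc[symmetric])
  qed
  also have "\<dots> \<le> ennreal (2 / M * s powr (a - 1)) + ennreal (2 * t * L ^ (n - 1)) *
       (\<rho> w ^ n * ennreal (sqrt 2 * s powr (1/2) * shell_weight p t w))"
    using wgt by (intro add_left_mono mult_left_mono) (auto simp flip: ennreal_1 intro: ennreal_leI)
  also have "\<dots> = ennreal (2 / M * s powr (a - 1)) + ennreal (2 * t * L ^ (n - 1) * (sqrt 2 * s powr (1/2))) *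
       (\<rho> w ^ n * ennreal (shell_weight p t w))"
    using L t s by (simp add: ennreal_mult mult_ac)
  finally show ?thesis unfolding e2 .
qed

text \<open>Integrate the pointwise bound over \<open>Z\<close> and s and exchange the integrals.
  For fixed s the substitution w = e + s(z - e) uses up the factor s^n, and the integral of s^(a-1)
  over the unit interval is 1/a = 2n.\<close>

lemma average_segment_integral_bound:
  fixes \<rho> :: "'a::euclidean_space \<Rightarrow> ennreal" and p e :: 'a
  defines "n \<equiv> DIM('a)"
  assumes \<rho>[measurable]: "\<rho> \<in> borel_measurable borel" and Z[measurable]: "Z \<in> sets borel"
    and t: "0 < t" and e: "dist p e = t" and Zt: "Z \<subseteq> ball p t" and M: "0 < M"
    and far: "\<And>z s. z \<in> Z \<Longrightarrow> 0 < s \<Longrightarrow> s \<le> 1 \<Longrightarrow> t / 9 \<le> dist p (e + s *\<^sub>R (z - e))"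
  shows "(\<integral>\<^sup>+ z \<in> Z. segment_integral \<rho> e z \<partial>lborel) \<le>
     ennreal (4 * n / M) * emeasure lborel Z +
     ennreal (4 * sqrt 2 * n * M ^ (n - 1) * t ^ n) *
       (\<integral>\<^sup>+ w. \<rho> w ^ n * ennreal (shell_weight p t w) \<partial>lborel)"
proof -
  define a where "a = 1 / (2 * real n)"
  have n: "n \<ge> 1" by (simp add: n_def Suc_leI)
  have a: "a > 0" using n by (simp add: a_def)
  define G where "G = (\<lambda>w. \<rho> w ^ n * ennreal (shell_weight p t w))"
  have G[measurable]: "G \<in> borel_measurable borel" unfolding G_def by measurable
  define c where "c = 2 * sqrt 2 * M ^ (n - 1) * t ^ n"
  have c: "c \<ge> 0" using M t by (simp add: c_def)
  have powr: "(\<integral>\<^sup>+ s. ennreal (s powr (a - 1)) * indicator {0..1} s \<partial>lborel) = ennreal (2 * n)"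
    using nn_integral_powr_unit_interval[of "a - 1"] a by (simp add: a_def)
  define h1 where "h1 = (\<lambda>z s. indicator Z z * (ennreal (2 / M) * (ennreal (s powr (a - 1)) * indicator {0..1::real} s)))"
  define h2 where "h2 = (\<lambda>z s. ennreal (c * s powr (a - 1) * s ^ n) * indicator {0..1} s * (indicator Z z * G (e + s *\<^sub>R (z - e))))"
  have h1m[measurable]: "(\<lambda>(z, s). h1 z s) \<in> borel_measurable (borel \<Otimes>\<^sub>M borel)"
    unfolding h1_def by measurable
  have h2m[measurable]: "(\<lambda>(z, s). h2 z s) \<in> borel_measurable (borel \<Otimes>\<^sub>M borel)"
    unfolding h2_def by measurable
  have "(\<integral>\<^sup>+ z \<in> Z. segment_integral \<rho> e z \<partial>lborel) =
      (\<integral>\<^sup>+ z. (\<integral>\<^sup>+ s. indicator Z z * (indicator {0..1} s * (ennreal (dist e z) * \<rho> (e + s *\<^sub>R (z - e)))) \<partial>lborel) \<partial>lborel)"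
    unfolding segment_integral_def
    by (intro nn_integral_cong) (simp add: nn_integral_cmult[symmetric] nn_integral_multc[symmetric] mult_ac)
  also have "\<dots> \<le> (\<integral>\<^sup>+ z. (\<integral>\<^sup>+ s. h1 z s + h2 z s \<partial>lborel) \<partial>lborel)"
  proof (rule nn_integral_mono, rule nn_integral_mono_AE)
    fix z
    have "AE s in lborel. s \<noteq> (0::real)" by (rule AE_lborel_singleton)
    then show "AE s in lborel. indicator Z z * (indicator {0..1} s * (ennreal (dist e z) * \<rho> (e + s *\<^sub>R (z - e)))) \<le> h1 z s + h2 z s"
    proof eventually_elim
      case (elim s)
      show ?case
      proof (cases "z \<in> Z \<and> s \<in> {0..1}")
        case True
        then have *: "dist p z < t" "0 < s" "s \<le> 1" using Zt elim by auto
        show ?thesis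
          using segment_integrand_bound[OF t e *(1,2,3) M far[OF _ *(2,3)], of \<rho>] True M
          by (simp add: h1_def h2_def G_def c_def a_def n_def
              ennreal_mult[symmetric] mult.assoc[symmetric])
      qed auto
    qed
  qed
  also have "\<dots> = (\<integral>\<^sup>+ z. (\<integral>\<^sup>+ s. h1 z s \<partial>lborel) + (\<integral>\<^sup>+ s. h2 z s \<partial>lborel) \<partial>lborel)"
    by (intro nn_integral_cong nn_integral_add) measurable
  also have "\<dots> = (\<integral>\<^sup>+ z. (\<integral>\<^sup>+ s. h1 z s \<partial>lborel) \<partial>lborel) + (\<integral>\<^sup>+ z. (\<integral>\<^sup>+ s. h2 z s \<partial>lborel) \<partial>lborel)"
    by (intro nn_integral_add) measurable
  also have "(\<integral>\<^sup>+ z. (\<integral>\<^sup>+ s. h1 z s \<partial>lborel) \<partial>lborel) = ennreal (4 * n / M) * emeasure lborel Z"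
  proof -
    have "(\<integral>\<^sup>+ s. h1 z s \<partial>lborel) = ennreal (4 * n / M) * indicator Z z" for z
      using M unfolding h1_def
      by (simp add: nn_integral_cmult powr) (simp add: ennreal_mult[symmetric] mult.commute)
    then show ?thesis by (simp add: nn_integral_cmult)
  qed
  also have "(\<integral>\<^sup>+ z. (\<integral>\<^sup>+ s. h2 z s \<partial>lborel) \<partial>lborel) = (\<integral>\<^sup>+ s. (\<integral>\<^sup>+ z. h2 z s \<partial>lborel) \<partial>lborel)"
    by (rule lborel_pair.Fubini'[symmetric]) (simp add: h2m)
  also have "\<dots> \<le> (\<integral>\<^sup>+ s. ennreal c * (ennreal (s powr (a - 1)) * indicator {0..1} s) * (\<integral>\<^sup>+ w. G w \<partial>lborel) \<partial>lborel)"
  proof (intro nn_integral_mono_AE)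
    have "AE s in lborel. s \<noteq> (0::real)" by (rule AE_lborel_singleton)
    then show "AE s in lborel. (\<integral>\<^sup>+ z. h2 z s \<partial>lborel) \<le>
       ennreal c * (ennreal (s powr (a - 1)) * indicator {0..1} s) * (\<integral>\<^sup>+ w. G w \<partial>lborel)"
    proof eventually_elim
      case (elim s)
      show ?case
      proof (cases "s \<in> {0..1}")
        case True
        then have s: "0 < s" using elim by auto
        have "(\<integral>\<^sup>+ z. h2 z s \<partial>lborel) =
           ennreal (c * s powr (a - 1) * s ^ n) * (\<integral>\<^sup>+ z. indicator Z z * G (e + s *\<^sub>R (z - e)) \<partial>lborel)"
          using True unfolding h2_def by (simp add: nn_integral_cmult)
        \<comment> \<open>Dropping the restriction to \<open>Z\<close> makes the substituted
          integral independent of s and of the end point \<open>e\<close>.\<close>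
        also have "\<dots> \<le> ennreal (c * s powr (a - 1) * s ^ n) * (\<integral>\<^sup>+ z. G ((e - s *\<^sub>R e) + s *\<^sub>R z) \<partial>lborel)"
          by (intro mult_left_mono nn_integral_mono) (auto simp: indicator_def algebra_simps)
        also have "\<dots> = ennreal c * ennreal (s powr (a - 1)) * (ennreal (s ^ n) * (\<integral>\<^sup>+ z. G ((e - s *\<^sub>R e) + s *\<^sub>R z) \<partial>lborel))"
          using c s by (simp add: ennreal_mult mult_ac)
        also have "\<dots> = ennreal c * ennreal (s powr (a - 1)) * (\<integral>\<^sup>+ w. G w \<partial>lborel)"
          unfolding n_def by (subst nn_integral_lborel_affine[OF G s, of "e - s *\<^sub>R e"]) simp
        finally show ?thesis using True by simp
      qed (simp add: h2_def)
    qed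
  qed
  also have "\<dots> = ennreal c * ennreal (2 * n) * (\<integral>\<^sup>+ w. G w \<partial>lborel)"
    by (simp add: nn_integral_cmult nn_integral_multc powr)
  also have "ennreal c * ennreal (2 * n) = ennreal (4 * sqrt 2 * n * M ^ (n - 1) * t ^ n)"
    using c by (simp add: ennreal_mult[symmetric] c_def mult_ac)
  finally show ?thesis by (simp add: G_def)
qed

lemma borel_measurable_segment_integral [measurable]:
  assumes [measurable]: "\<rho> \<in> borel_measurable borel"
  shows "segment_integral \<rho> e \<in> borel_measurable borel"
  unfolding segment_integral_def by measurable

text \<open>The direction of u + w works, by Cauchy-Schwarz and equality of the norms; for opposite
  vectors any orthogonal direction does, which needs dimension 2. It places one ball of intermediate
  points on the side of both end points.\<close>

lemma exists_unit_vector_inner_nonneg: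
  fixes u w :: "'a::euclidean_space"
  assumes "2 \<le> DIM('a)" and "norm u = norm w"
  obtains v where "norm v = 1" "0 \<le> u \<bullet> v" "0 \<le> w \<bullet> v"
proof (cases "u + w = 0")
  case True
  obtain y where y: "y \<noteq> 0" "orthogonal u y" using orthogonal_to_vector_exists[OF assms(1)] .
  have "w = - u" using True by (simp add: eq_neg_iff_add_eq_0 add.commute)
  then show thesis using y by (intro that[of "y /\<^sub>R norm y"]) (auto simp: orthogonal_def)
next
  case False
  have "0 \<le> u \<bullet> (u + w)" "0 \<le> w \<bullet> (u + w)"
    using Cauchy_Schwarz_ineq2[of u w] assms(2)
    by (auto simp: inner_add_right dot_square_norm power2_eq_square inner_commute abs_le_iff)
  then show thesis using False by (intro that[of "(u + w) /\<^sub>R norm (u + w)"]) auto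
qed

lemma segment_to_half_ball_far_from_center:
  fixes p e v z :: "'a::euclidean_space"
  assumes t: "0 < t" and v: "norm v = 1" and e: "dist p e = t" "0 \<le> (e - p) \<bullet> v"
    and z: "z \<in> ball (p + (t / 2) *\<^sub>R v) (t / 4)" and s: "0 < s" "s \<le> 1"
  shows "dist p z < t" "t / 9 \<le> dist p (e + s *\<^sub>R (z - e))"
proof -
  define d where "d = z - (p + (t / 2) *\<^sub>R v)"
  have d: "norm d < t / 4" using z by (simp add: d_def dist_norm norm_minus_commute)
  have zd: "z = p + ((t / 2) *\<^sub>R v + d)" by (simp add: d_def)
  have "dist p z = norm (z - p)" by (simp add: dist_norm norm_minus_commute)
  also have "\<dots> = norm ((t / 2) *\<^sub>R v + d)" by (simp add: zd)
  also have "\<dots> \<le> t / 2 + norm d" using norm_triangle_ineq[of "(t / 2) *\<^sub>R v" d] t v by simp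
  finally show pz: "dist p z < t" using d t by linarith
  have "\<bar>d \<bullet> v\<bar> \<le> t / 4" using Cauchy_Schwarz_ineq2[of d v] v d by simp
  moreover have "(z - p) \<bullet> v = t / 2 + d \<bullet> v" using v by (simp add: zd inner_add_left dot_square_norm)
  ultimately have zv: "t / 4 \<le> (z - p) \<bullet> v" by linarith
  define w where "w = e + s *\<^sub>R (z - e)"
  have "w - p = (1 - s) *\<^sub>R (e - p) + s *\<^sub>R (z - p)" by (simp add: w_def algebra_simps)
  then have "(w - p) \<bullet> v = (1 - s) * ((e - p) \<bullet> v) + s * ((z - p) \<bullet> v)"
    by (simp add: inner_add_left)
  also have "\<dots> \<ge> 0 + s * (t / 4)"
    using s e zv by (intro add_mono mult_left_mono mult_nonneg_nonneg) auto
  finally have "s * (t / 4) \<le> (w - p) \<bullet> v" by simp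
  also have "\<dots> \<le> norm (w - p)" using Cauchy_Schwarz_ineq2[of "w - p" v] v by simp
  finally have 1: "s * (t / 4) \<le> dist p w" by (simp add: dist_norm norm_minus_commute)
  have "dist w e = s * dist z e" using s by (simp add: w_def dist_norm)
  moreover have "dist z e \<le> 2 * t" using dist_triangle[of z e p] pz e by (simp add: dist_commute)
  ultimately have "dist w e \<le> s * (2 * t)" using s by simp
  then have 2: "t - s * (2 * t) \<le> dist p w" using dist_triangle[of p e w] e by simp
  \<comment> \<open>The lower bounds s t/4 and t - 2 s t cross at s = 4/9 with common value t/9, so
    one of them is always at least t/9.\<close>
  show "t / 9 \<le> dist p (e + s *\<^sub>R (z - e))"
    using 1 2 unfolding w_def by simp
qed

lemma shell_integral_lower_bound:
  assumes "2 \<le> DIM('a::euclidean_space)"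
  obtains A where "0 < A"
    "\<And>\<rho> (p::'a) e g t. \<rho> \<in> borel_measurable borel \<Longrightarrow> 0 < t \<Longrightarrow> dist p e = t \<Longrightarrow> dist p g = t \<Longrightarrow>
       (\<And>z. z \<in> ball p t \<Longrightarrow> 1 \<le> segment_integral \<rho> e z + segment_integral \<rho> g z) \<Longrightarrow>
       1 \<le> ennreal A * (\<integral>\<^sup>+ w. \<rho> w ^ DIM('a) * ennreal (shell_weight p t w) \<partial>lborel)"
proof -
  define n where "n = DIM('a)"
  have n: "n \<ge> 1" by (simp add: n_def Suc_leI)
  \<comment> \<open>With this value 4n/M = 1/4: the constant parts for the two end points use up
    half of the volume of the ball \<open>Z\<close>, and the other half bounds the energy.\<close>
  define M where "M = 16 * real n"
  have M: "M > 0" using n by (simp add: M_def)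
  define B where "B = 4 * sqrt 2 * n * M ^ (n - 1)"
  have B: "B > 0" using n M by (simp add: B_def)
  define V where "V = unit_ball_vol (real n)"
  have V: "V > 0" by (simp add: V_def)
  define A where "A = 4 * 4 ^ n * B / V"
  have A: "A > 0" using B V by (simp add: A_def)
  have "1 \<le> ennreal A * (\<integral>\<^sup>+ w. \<rho> w ^ DIM('a) * ennreal (shell_weight p t w) \<partial>lborel)"
    if \<rho>[measurable]: "\<rho> \<in> borel_measurable borel" and t: "0 < t" and e: "dist p e = t" and g: "dist p g = t"
      and adm: "\<And>z. z \<in> ball p t \<Longrightarrow> 1 \<le> segment_integral \<rho> e z + segment_integral \<rho> g z"
    for \<rho> and p e g :: 'a and t
  proof -
    define J where "J = (\<integral>\<^sup>+ w. \<rho> w ^ n * ennreal (shell_weight p t w) \<partial>lborel)"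
    obtain v where v: "norm v = 1" "0 \<le> (e - p) \<bullet> v" "0 \<le> (g - p) \<bullet> v"
      using exists_unit_vector_inner_nonneg[OF assms, of "e - p" "g - p"] e g
      by (metis dist_commute dist_norm)
    define Z where "Z = ball (p + (t / 2) *\<^sub>R v) (t / 4)"
    have [measurable]: "Z \<in> sets borel" by (simp add: Z_def)
    have Zt: "Z \<subseteq> ball p t"
      using segment_to_half_ball_far_from_center(1)[OF t v(1) e v(2), of _ 1] by (auto simp: Z_def)
    have volZ: "emeasure lborel Z = ennreal (V * (t / 4) ^ n)"
      using t by (simp add: Z_def emeasure_ball V_def n_def)
    have bnd: "(\<integral>\<^sup>+ z \<in> Z. segment_integral \<rho> u z \<partial>lborel) \<le> ennreal (1 / 4) * emeasure lborel Z + ennreal (B * t ^ n) * J"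
      if "dist p u = t" "0 \<le> (u - p) \<bullet> v" for u
    proof -
      have M4: "4 * real n / M = 1 / 4" using n by (simp add: M_def)
      have "t / 9 \<le> dist p (u + s *\<^sub>R (z - u))" if "z \<in> Z" "0 < s" "s \<le> 1" for z s
        using segment_to_half_ball_far_from_center(2)[OF t v(1) \<open>dist p u = t\<close> \<open>0 \<le> (u - p) \<bullet> v\<close>] that
        unfolding Z_def by blast
      from average_segment_integral_bound[OF \<rho> \<open>Z \<in> sets borel\<close> t that(1) Zt M this]
      show ?thesis unfolding n_def[symmetric] J_def[symmetric] M4 B_def[symmetric] .
    qed
    have "emeasure lborel Z = (\<integral>\<^sup>+ z. indicator Z z \<partial>lborel)" by simp
    also have "\<dots> \<le> (\<integral>\<^sup>+ z. segment_integral \<rho> e z * indicator Z z + segment_integral \<rho> g z * indicator Z z \<partial>lborel)"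
      using adm Zt by (intro nn_integral_mono) (auto simp: indicator_def)
    also have "\<dots> = (\<integral>\<^sup>+ z \<in> Z. segment_integral \<rho> e z \<partial>lborel) + (\<integral>\<^sup>+ z \<in> Z. segment_integral \<rho> g z \<partial>lborel)"
      by (intro nn_integral_add) measurable
    also have "\<dots> \<le> (ennreal (1 / 4) * emeasure lborel Z + ennreal (B * t ^ n) * J) +
        (ennreal (1 / 4) * emeasure lborel Z + ennreal (B * t ^ n) * J)"
      by (intro add_mono bnd e g v)
    finally have main: "emeasure lborel Z \<le> \<dots>" .
    show ?thesis
    proof (cases J)
      case (real j)
      have tn: "t ^ n > 0" using t by simp
      have "V * (t / 4) ^ n \<le> 1/4 * (V * (t / 4) ^ n) + B * t ^ n * j + (1/4 * (V * (t / 4) ^ n) + B * t ^ n * j)"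
        using main real V B t unfolding volZ
        by (simp add: ennreal_mult[symmetric] ennreal_plus[symmetric] del: ennreal_plus)
      then have "V * (t / 4) ^ n \<le> 4 * (B * t ^ n * j)" by linarith
      then have "V * (t ^ n / 4 ^ n) \<le> 4 * (B * t ^ n * j)" by (simp add: power_divide)
      \<comment> \<open>Both sides scale like t^n, so \<open>A\<close> does not depend on the radius
        of the shell.\<close>
      then have "t ^ n * V \<le> t ^ n * (4 * 4 ^ n * B * j)" by (simp add: field_simps)
      then have "V \<le> 4 * 4 ^ n * B * j" using tn by simp
      then have "1 \<le> A * j" using V by (simp add: A_def field_simps)
      then show ?thesis using real A unfolding J_def[symmetric] n_def[symmetric]
        by (simp add: ennreal_mult[symmetric])
    next
      case top
      then show ?thesis using A unfolding J_def[symmetric] n_def[symmetric] by (simp add: ennreal_mult_top)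
    qed
  qed
  then show thesis using that[OF A] by blast
qed

text \<open>With r the distance of \<open>w\<close> from \<open>p\<close>, the integrand vanishes
  unless r < t <= 9r, where it equals 1/sqrt(t(t-r)). Substituting t = r + 8rs and using t >= r
  under the root gives at most 2 sqrt 8, which is below 6.\<close>

lemma shell_weight_log_integral:
  "(\<integral>\<^sup>+ t \<in> {0<..<R}. ennreal (shell_weight p t w / t) \<partial>lborel) \<le> 6 * indicator (ball p R) w"
proof -
  define r where "r = dist p w"
  consider "R \<le> r" | "r = 0" | "0 < r" "r < R"
    unfolding r_def by fastforce
  then show ?thesis
  proof cases
    case 1
    then have "(\<integral>\<^sup>+ t \<in> {0<..<R}. ennreal (shell_weight p t w / t) \<partial>lborel) = (\<integral>\<^sup>+ t. 0 \<partial>(lborel :: real measure))"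
      by (intro nn_integral_cong) (auto simp: shell_weight_def r_def indicator_def)
    then show ?thesis by simp
  next
    case 2
    then have "(\<integral>\<^sup>+ t \<in> {0<..<R}. ennreal (shell_weight p t w / t) \<partial>lborel) = (\<integral>\<^sup>+ t. 0 \<partial>(lborel :: real measure))"
      by (intro nn_integral_cong) (auto simp: shell_weight_def r_def indicator_def)
    then show ?thesis by simp
  next
    case 3
    define F where "F = (\<lambda>t. ennreal (shell_weight p t w / t) * indicator {0<..<R} t)"
    have [measurable]: "F \<in> borel_measurable borel" unfolding F_def shell_weight_def by measurable
    have "(\<integral>\<^sup>+ t. F t \<partial>lborel) = ennreal \<bar>8 * r\<bar> * (\<integral>\<^sup>+ s. F (r + 8 * r * s) \<partial>lborel)"
      by (rule nn_integral_real_affine) (use 3 in auto)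
    also have "\<dots> = ennreal (8 * r) * (\<integral>\<^sup>+ s. F (r + 8 * r * s) \<partial>lborel)" using 3 by simp
    also have "\<dots> \<le> ennreal (8 * r) * (\<integral>\<^sup>+ s. ennreal (1 / (sqrt 8 * r)) * (ennreal (s powr (-1/2)) * indicator {0..1} s) \<partial>lborel)"
    proof (intro mult_left_mono nn_integral_mono)
      fix s :: real
      define t where "t = r + 8 * r * s"
      show "F t \<le> ennreal (1 / (sqrt 8 * r)) * (ennreal (s powr (-1/2)) * indicator {0..1} s)"
      proof (cases "0 < s \<and> s \<le> 1 \<and> t < R")
        case True
        then have tr: "t \<ge> r" "t > 0" using 3 by (auto simp: t_def add_pos_pos)
        have "sqrt (t / (t - r)) / t = 1 / sqrt (t * (8 * r * s))"
        proof -
          have "sqrt (t / u) / t = 1 / sqrt (t * u)" if "u > 0" for u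
            using tr that by (simp add: real_sqrt_divide real_sqrt_mult divide_simps)
          moreover have "t - r = 8 * r * s" "0 < 8 * r * s" using True 3 by (auto simp: t_def)
          ultimately show ?thesis by simp
        qed
        also have "\<dots> \<le> 1 / sqrt (r * (8 * r * s))"
          using tr True 3 by (intro divide_left_mono real_sqrt_le_mono mult_right_mono) auto
        also have "\<dots> = 1 / (sqrt 8 * r) * s powr (-1/2)"
          using True 3 by (simp add: real_sqrt_mult powr_minus powr_half_sqrt field_simps)
        finally have "shell_weight p t w / t \<le> 1 / (sqrt 8 * r) * s powr (-1/2)"
          using True 3 tr by (auto simp: shell_weight_def r_def[symmetric])
        then have "ennreal (shell_weight p t w / t) \<le> ennreal (1 / (sqrt 8 * r) * s powr (-1/2))"
          by (rule ennreal_leI)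
        then show ?thesis using True tr 3
          by (simp add: F_def ennreal_mult[symmetric])
      next
        case False
        have "F t = 0"
        proof (cases "s \<le> 0 \<or> 1 < s")
          case True
          then have "t \<le> r \<or> 9 * r < t" using 3 by (auto simp: t_def mult_nonneg_nonpos)
          then show ?thesis by (auto simp: F_def shell_weight_def r_def[symmetric])
        qed (use False in \<open>auto simp: F_def\<close>)
        then show ?thesis by simp
      qed
    qed auto
    also have "\<dots> = ennreal (8 * r) * (ennreal (1 / (sqrt 8 * r)) * ennreal 2)"
      using nn_integral_powr_unit_interval[of "-1/2"] by (simp add: nn_integral_cmult)
    also have "\<dots> = ennreal (2 * sqrt 8)"
    proof -
      have "8 * r * (1 / (sqrt 8 * r) * 2) = 2 * sqrt 8" using 3 by (simp add: field_simps)
      then show ?thesis using 3 by (simp add: ennreal_mult[symmetric] del: ennreal_numeral)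
    qed
    also have "\<dots> \<le> ennreal 6"
    proof (rule ennreal_leI)
      have "sqrt 8 \<le> (3::real)" by (rule real_le_lsqrt) auto
      then show "2 * sqrt 8 \<le> (6::real)" by simp
    qed
    finally show ?thesis using 3 by (simp add: F_def r_def)
  qed
qed

text \<open>Integrating the shell bound against dt/t produces the logarithm on the left. After
  exchanging the integrals on the right, each point \<open>w\<close> of the ball is charged at most
  6 times.\<close>

lemma log_le_energy:
  fixes \<rho> :: "'a::euclidean_space \<Rightarrow> ennreal"
  assumes \<rho>[measurable]: "\<rho> \<in> borel_measurable borel" and \<delta>: "0 < \<delta>" "\<delta> < R" and A: "0 \<le> A"
    and low: "\<And>t. \<delta> < t \<Longrightarrow> t < R \<Longrightarrow>
      1 \<le> ennreal A * (\<integral>\<^sup>+ w. \<rho> w ^ n * ennreal (shell_weight p t w) \<partial>lborel)"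
  shows "ennreal (ln (R / \<delta>)) \<le> ennreal (6 * A) * (\<integral>\<^sup>+ w \<in> ball p R. \<rho> w ^ n \<partial>lborel)"
proof -
  have [measurable]: "ball p R \<in> sets borel" by simp
  have "ennreal (ln (R / \<delta>)) = (\<integral>\<^sup>+ t. ennreal (1 / t) * indicator {\<delta>..R} t \<partial>lborel)"
    using \<delta> by (subst nn_integral_FTC_Icc[where F=ln]) (auto intro!: derivative_eq_intros simp: ln_div)
  also have "\<dots> \<le> (\<integral>\<^sup>+ t. (\<integral>\<^sup>+ w. ennreal A * (\<rho> w ^ n * (ennreal (shell_weight p t w / t) * indicator {0<..<R} t)) \<partial>lborel) \<partial>lborel)"
  proof (rule nn_integral_mono_AE)
    have "AE t in lborel. t \<noteq> \<delta>" "AE t in lborel. t \<noteq> R" by (rule AE_lborel_singleton)+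
    then show "AE t in lborel. ennreal (1 / t) * indicator {\<delta>..R} t \<le>
      (\<integral>\<^sup>+ w. ennreal A * (\<rho> w ^ n * (ennreal (shell_weight p t w / t) * indicator {0<..<R} t)) \<partial>lborel)"
    proof eventually_elim
      case (elim t)
      show ?case
      proof (cases "t \<in> {\<delta>..R}")
        case True
        then have t: "\<delta> < t" "t < R" "0 < t" using elim \<delta> by auto
        have "ennreal (1 / t) * 1 \<le> ennreal (1 / t) * (ennreal A * (\<integral>\<^sup>+ w. \<rho> w ^ n * ennreal (shell_weight p t w) \<partial>lborel))"
          using low[OF t(1,2)] by (rule mult_left_mono) simp
        also have "\<dots> = (\<integral>\<^sup>+ w. ennreal (1 / t) * (ennreal A * (\<rho> w ^ n * ennreal (shell_weight p t w))) \<partial>lborel)"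
          by (simp add: nn_integral_cmult)
        also have "\<dots> = (\<integral>\<^sup>+ w. ennreal A * (\<rho> w ^ n * (ennreal (shell_weight p t w / t) * indicator {0<..<R} t)) \<partial>lborel)"
          using t by (intro nn_integral_cong) (simp add: divide_inverse ennreal_mult mult_ac)
        finally show ?thesis using True by simp
      qed simp
    qed
  qed
  also have "\<dots> = (\<integral>\<^sup>+ w. (\<integral>\<^sup>+ t. ennreal A * (\<rho> w ^ n * (ennreal (shell_weight p t w / t) * indicator {0<..<R} t)) \<partial>lborel) \<partial>lborel)"
    by (rule lborel_pair.Fubini') (simp, measurable)
  also have "\<dots> = (\<integral>\<^sup>+ w. ennreal A * (\<rho> w ^ n * (\<integral>\<^sup>+ t \<in> {0<..<R}. ennreal (shell_weight p t w / t) \<partial>lborel)) \<partial>lborel)"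
  proof -
    have [measurable]: "(\<lambda>t. shell_weight p t w) \<in> borel_measurable borel" for w
      unfolding shell_weight_def by measurable
    show ?thesis by (simp add: nn_integral_cmult)
  qed
  also have "\<dots> \<le> (\<integral>\<^sup>+ w. ennreal A * (\<rho> w ^ n * (6 * indicator (ball p R) w)) \<partial>lborel)"
    by (intro nn_integral_mono mult_left_mono shell_weight_log_integral) auto
  also have "\<dots> = (\<integral>\<^sup>+ w. ennreal (6 * A) * (\<rho> w ^ n * indicator (ball p R) w) \<partial>lborel)"
    using A by (intro nn_integral_cong) (simp add: ennreal_mult mult_ac)
  also have "\<dots> = ennreal (6 * A) * (\<integral>\<^sup>+ w \<in> ball p R. \<rho> w ^ n \<partial>lborel)"
    by (rule nn_integral_cmult) measurable
  finally show ?thesis .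
qed

section \<open>Lower bound for the modulus\<close>

text \<open>Where x^n exceeds \<open>s\<close>, write x^n = (x^n)^(1-q/n) x^q and use that the
  exponent 1 - q/n is not positive. Integrated over the unit ball, this passes from the n-energy to
  the q-energy.\<close>

lemma power_le_add_ennreal_powr:
  fixes x :: ennreal
  assumes s: "0 < s" and n: "n \<ge> 1" and q: "real n \<le> q"
  shows "x ^ n \<le> ennreal s + ennreal (s powr (1 - q / real n)) * ennreal_powr x q"
proof (cases x)
  case (real r)
  show ?thesis
  proof (cases "r ^ n \<le> s")
    case True
    then have "x ^ n \<le> ennreal s" using real by (simp add: ennreal_power ennreal_leI)
    then show ?thesis by (rule order_trans) simp
  next
    case False
    then have r: "r > 0" using real s n by (cases "r = 0") (auto simp: power_0_left)
    have "r ^ n = (r ^ n) powr (1 - q / real n) * (r ^ n) powr (q / real n)"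
      using r by (simp add: powr_add[symmetric])
    also have "(r ^ n) powr (q / real n) = r powr q"
      using r n by (simp add: powr_realpow[symmetric] powr_powr)
    also have "(r ^ n) powr (1 - q / real n) * r powr q \<le> s powr (1 - q / real n) * r powr q"
      using False s n q by (intro mult_right_mono powr_mono2') (auto simp: field_simps)
    finally have "x ^ n \<le> ennreal (s powr (1 - q / real n)) * ennreal_powr x q"
      using real r by (simp add: ennreal_power ennreal_powr_def ennreal_mult[symmetric] ennreal_leI)
    then show ?thesis by (rule order_trans) simp
  qed
next
  case top
  then show ?thesis using s n by (simp add: ennreal_powr_def ennreal_mult_top)
qed

lemma borel_measurable_ennreal_powr [measurable]:
  assumes [measurable]: "f \<in> borel_measurable M"
  shows "(\<lambda>x. ennreal_powr (f x) q) \<in> borel_measurable M"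
  unfolding ennreal_powr_def by measurable

lemma connected_meets_sphere:
  fixes E :: "'a::metric_space set"
  assumes "connected E" "x \<in> E" "z \<in> E" "dist p x \<le> t" "t \<le> dist p z"
  obtains e where "e \<in> E" "dist p e = t"
proof -
  have "connected (dist p ` E)"
    by (intro connected_continuous_image continuous_intros assms(1))
  then have "t \<in> dist p ` E" using assms connectedD_interval by blast
  then show thesis using that by auto
qed

lemma path_modulus_lower_bound:
  assumes dim: "2 \<le> DIM('a::euclidean_space)" and q: "real DIM('a) \<le> q"
  obtains c where "0 < c"
    "\<And>(p::'a) \<delta> R E F. 0 < \<delta> \<Longrightarrow> \<delta> < R \<Longrightarrow> ball p R \<subseteq> ball 0 1 \<Longrightarrow>
       (\<And>t. \<delta> < t \<Longrightarrow> t < R \<Longrightarrow> (\<exists>e\<in>E. dist p e = t) \<and> (\<exists>g\<in>F. dist p g = t)) \<Longrightarrow>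
       ennreal (c * ln (R / \<delta>) powr (q / DIM('a))) \<le>
         path_modulus q (ball 0 1) (joining_paths E F (ball 0 1))"
proof -
  define n where "n = DIM('a)"
  have n: "n \<ge> 1" by (simp add: n_def Suc_leI)
  obtain A where A: "0 < A" and shell:
    "\<And>\<rho> (p::'a) e g t. \<rho> \<in> borel_measurable borel \<Longrightarrow> 0 < t \<Longrightarrow> dist p e = t \<Longrightarrow> dist p g = t \<Longrightarrow>
       (\<And>z. z \<in> ball p t \<Longrightarrow> 1 \<le> segment_integral \<rho> e z + segment_integral \<rho> g z) \<Longrightarrow>
       1 \<le> ennreal A * (\<integral>\<^sup>+ w. \<rho> w ^ DIM('a) * ennreal (shell_weight p t w) \<partial>lborel)"
    using shell_integral_lower_bound[OF dim] by blast
  define D where "D = ball (0::'a) 1"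
  have [measurable]: "D \<in> sets borel" by (simp add: D_def)
  define V where "V = unit_ball_vol (real n)"
  have V: "V > 0" by (simp add: V_def)
  have volD: "emeasure lborel D = ennreal V"
    by (simp add: D_def emeasure_ball V_def n_def)
  \<comment> \<open>This \<open>c\<close> makes c l^(q/n) = V s^(q/n) for the threshold s = l/(12 A
    V) chosen below, where l is the logarithm.\<close>
  define c where "c = V * (12 * A * V) powr (- (q / n))"
  have c: "c > 0" using V A by (simp add: c_def)
  have "ennreal (c * ln (R / \<delta>) powr (q / n)) \<le> path_modulus q D (joining_paths E F D)"
    if \<delta>: "0 < \<delta>" "\<delta> < R" and RD: "ball p R \<subseteq> D"
      and meet: "\<And>t. \<delta> < t \<Longrightarrow> t < R \<Longrightarrow> (\<exists>e\<in>E. dist p e = t) \<and> (\<exists>g\<in>F. dist p g = t)"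
    for p :: 'a and \<delta> R E F
    unfolding path_modulus_def
  proof (rule INF_greatest)
    fix \<rho> assume \<rho>: "\<rho> \<in> admissible (joining_paths E F D)"
    then have m[measurable]: "\<rho> \<in> borel_measurable borel" by (simp add: admissible_def)
    have low: "1 \<le> ennreal A * (\<integral>\<^sup>+ w. \<rho> w ^ n * ennreal (shell_weight p t w) \<partial>lborel)"
      if t: "\<delta> < t" "t < R" for t
    proof -
      obtain e g where e: "e \<in> E" "dist p e = t" and g: "g \<in> F" "dist p g = t"
        using meet[OF t] by blast
      have cb: "cball p t \<subseteq> D" using t RD by (force simp: subset_iff)
      show ?thesis
        unfolding n_def
      proof (rule shell[OF m _ e(2) g(2)])
        show "0 < t" using t \<delta> by simp
        \<comment> \<open>Convexity of the closed ball keeps the two-segment path inside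
          \<open>D\<close>, so admissibility of \<open>\<rho>\<close> applies to it. As
          \<open>z\<close> is interior, both segments are nondegenerate.\<close>
        fix z assume z: "z \<in> ball p t"
        then have "e \<noteq> z" "z \<noteq> g" using e g by auto
        then obtain b \<gamma> where \<gamma>: "0 < b" "continuous_on {0..b} \<gamma>" "\<gamma> 0 = e" "\<gamma> b = g"
          "\<gamma> ` {0..b} \<subseteq> closed_segment e z \<union> closed_segment z g" "locally_rectifiable 0 b \<gamma>"
          "line_integral \<rho> 0 b \<gamma> \<le> segment_integral \<rho> e z + segment_integral \<rho> g z"
          using two_segment_path[OF m] by metis
        have "closed_segment e z \<subseteq> cball p t" "closed_segment z g \<subseteq> cball p t"
          using e(2) g(2) z by (intro closed_segment_subset convex_cball; simp)+
        then have "\<gamma> ` {0..b} \<subseteq> D" using \<gamma>(5) cb by blast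
        then have "(0, b, \<gamma>) \<in> joining_paths E F D"
          using \<gamma>(1-4) e g by (auto simp: joining_paths_def)
        then have "1 \<le> line_integral \<rho> 0 b \<gamma>"
          using \<rho> \<gamma>(6) by (auto simp: admissible_def)
        then show "1 \<le> segment_integral \<rho> e z + segment_integral \<rho> g z"
          using \<gamma>(7) by (rule order_trans)
      qed
    qed
    define l where "l = ln (R / \<delta>)"
    have l: "l > 0" using \<delta> by (simp add: l_def)
    \<comment> \<open>The constant part of the splitting then contributes 6 A s V = l/2, which is
      absorbed on the left.\<close>
    define s where "s = l / (12 * A * V)"
    have s: "s > 0" using l A V by (simp add: s_def)
    define I where "I = (\<integral>\<^sup>+ x \<in> D. ennreal_powr (\<rho> x) q \<partial>lborel)"
    have "ennreal l \<le> ennreal (6 * A) * (\<integral>\<^sup>+ w \<in> ball p R. \<rho> w ^ n \<partial>lborel)"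
      unfolding l_def by (rule log_le_energy[OF m \<delta>]) (use A low in auto)
    also have "(\<integral>\<^sup>+ w \<in> ball p R. \<rho> w ^ n \<partial>lborel) \<le>
       (\<integral>\<^sup>+ w. ennreal s * indicator D w + ennreal (s powr (1 - q / n)) * (ennreal_powr (\<rho> w) q * indicator D w) \<partial>lborel)"
      using RD power_le_add_ennreal_powr[OF s n, of q] q
      by (intro nn_integral_mono) (auto simp: indicator_def n_def)
    also have "\<dots> = ennreal s * ennreal V + ennreal (s powr (1 - q / n)) * I"
      unfolding I_def by (subst nn_integral_add) (simp_all add: nn_integral_cmult volD)
    finally have main: "ennreal l \<le> ennreal (6 * A) * (ennreal s * ennreal V + ennreal (s powr (1 - q / n)) * I)"
      by (simp add: mult_left_mono)
    have "ennreal (c * l powr (q / n)) \<le> I"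
    proof (cases I)
      case (real i)
      have "l \<le> 6 * A * (s * V + s powr (1 - q / n) * i)"
        using main real A s V
        by (simp add: ennreal_mult[symmetric] ennreal_plus[symmetric] del: ennreal_plus)
      moreover have "6 * A * (s * V) = l / 2" using A V by (simp add: s_def field_simps)
      ultimately have "l \<le> 12 * A * (s powr (1 - q / n) * i)" by (simp add: distrib_left)
      moreover have "l = 12 * A * (s * V)" using A V by (simp add: s_def field_simps)
      ultimately have "s * V \<le> s powr (1 - q / n) * i" using A by simp
      then have "s powr (q / n - 1) * (s * V) \<le> s powr (q / n - 1) * (s powr (1 - q / n) * i)"
        by (rule mult_left_mono) simp
      also have "\<dots> = i" using s by (simp add: mult.assoc[symmetric] powr_add[symmetric])
      also have "s powr (q / n - 1) * (s * V) = V * s powr (q / n)" using s by (simp add: powr_diff)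
      also have "\<dots> = c * l powr (q / n)"
      proof -
        have "s powr (q / n) = l powr (q / n) / (12 * A * V) powr (q / n)"
          unfolding s_def by (rule powr_divide)
        then show ?thesis by (simp only: c_def powr_minus_divide) simp
      qed
      finally show ?thesis using real by (simp add: ennreal_leI)
    qed simp
    then show "ennreal (c * ln (R / \<delta>) powr (q / n)) \<le> (\<integral>\<^sup>+ x \<in> D. ennreal_powr (\<rho> x) q \<partial>lebesgue)"
      by (simp add: l_def I_def nn_integral_completion)
  qed
  then show thesis using that[OF c] unfolding D_def n_def by blast
qed

lemma inverse_Poletsky_local_estimate:
  assumes dim: "2 \<le> DIM('a::euclidean_space)" and q: "real DIM('a) \<le> q"
  obtains C where "0 < C"
    "\<And>Q f (x::'a) y. Q \<in> borel_measurable lebesgue \<Longrightarrow> (\<integral>\<^sup>+ y. Q y \<partial>lebesgue) < \<infinity> \<Longrightarrow>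
       f \<in> inverse_Poletsky q Q (ball 0 1) \<Longrightarrow> x \<in> ball 0 1 \<Longrightarrow> x \<noteq> y \<Longrightarrow>
       dist x y \<le> (1 - norm x) / 4 \<Longrightarrow>
       norm (f x - f y) \<le> C * (L1_norm Q powr (1 / q) /
         ln (1 + (1 - norm x) / (2 * dist x y)) powr (1 / DIM('a)))"
proof -
  obtain c where c: "0 < c" and mod:
    "\<And>(p::'a) \<delta> R E F. 0 < \<delta> \<Longrightarrow> \<delta> < R \<Longrightarrow> ball p R \<subseteq> ball 0 1 \<Longrightarrow>
       (\<And>t. \<delta> < t \<Longrightarrow> t < R \<Longrightarrow> (\<exists>e\<in>E. dist p e = t) \<and> (\<exists>g\<in>F. dist p g = t)) \<Longrightarrow>
       ennreal (c * ln (R / \<delta>) powr (q / DIM('a))) \<le>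
         path_modulus q (ball 0 1) (joining_paths E F (ball 0 1))"
    using path_modulus_lower_bound[OF dim q] by blast
  define n where "n = real DIM('a)"
  have n: "n > 0" "q > 0" using dim q by (auto simp: n_def)
  define C where "C = c powr (- (1 / q)) * 2 powr (1 / n)"
  have C: "C > 0" using c by (simp add: C_def)
  have "norm (f x - f y) \<le> C * (L1_norm Q powr (1 / q) / ln (1 + (1 - norm x) / (2 * dist x y)) powr (1 / n))"
    if Q: "Q \<in> borel_measurable lebesgue" "(\<integral>\<^sup>+ y. Q y \<partial>lebesgue) < \<infinity>"
      and f: "f \<in> inverse_Poletsky q Q (ball 0 1)" and x: "x \<in> ball 0 1" and "x \<noteq> y"
      and xy: "dist x y \<le> (1 - norm x) / 4" for Q f and x y :: 'a
  proof (cases "f x = f y")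
    case True
    then show ?thesis using C by simp
  next
    case False
    define \<delta> d where "\<delta> = dist x y" and "d = 1 - norm x"
    have \<delta>: "0 < \<delta>" "\<delta> \<le> d / 4" using \<open>x \<noteq> y\<close> xy by (auto simp: \<delta>_def d_def)
    \<comment> \<open>The ball of radius \<open>r\<close> contains \<open>x\<close> and
      \<open>y\<close>, while its boundary is at distance at least d/2 from \<open>x\<close>. Hence
      both continua cross every sphere about \<open>x\<close> with radius between |x - y| and
      d/2.\<close>
    define r where "r = 1 - d / 2"
    have r: "x \<in> ball 0 r" "r < 1" using \<delta> by (auto simp: r_def d_def field_simps)
    have "norm y \<le> norm x + \<delta>" using norm_triangle_sub[of y x] by (simp add: \<delta>_def dist_norm norm_minus_commute)
    then have yr: "y \<in> ball 0 r" using \<delta> by (simp add: r_def d_def field_simps)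
    obtain E F where E: "continuum E" "x \<in> E" "\<exists>z\<in>E. norm z = r"
      and F: "continuum F" "y \<in> F" "\<exists>z\<in>F. norm z = r"
      and up: "path_modulus q (ball 0 1) (joining_paths E F (ball 0 1)) \<le>
         ennreal (norm (f x - f y) powr (-q)) * (\<integral>\<^sup>+ y. Q y \<partial>lebesgue)"
      by (rule continua_modulus_bound[OF f Q(1) r(1) yr r(2) False])
    have far: "d / 2 \<le> dist x z" if "norm z = r" for z
      using norm_triangle_sub[of z x] that by (simp add: dist_norm norm_minus_commute r_def d_def field_simps)
    have "ball x (d / 2) \<subseteq> ball 0 1"
    proof
      fix w assume "w \<in> ball x (d / 2)"
      then show "w \<in> ball 0 1"
        using norm_triangle_sub[of w x] \<delta> by (simp add: dist_norm norm_minus_commute d_def field_simps)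
    qed
    moreover have "(\<exists>e\<in>E. dist x e = t) \<and> (\<exists>g\<in>F. dist x g = t)" if t: "\<delta> < t" "t < d / 2" for t
    proof
      obtain z where "z \<in> E" "norm z = r" using E by blast
      then show "\<exists>e\<in>E. dist x e = t"
        using connected_meets_sphere[of E x z x t] E far[of z] t \<delta> by (auto simp: continuum_def)
      obtain z where "z \<in> F" "norm z = r" using F by blast
      then show "\<exists>g\<in>F. dist x g = t"
        using connected_meets_sphere[of F y z x t] F far[of z] t \<delta> by (auto simp: continuum_def \<delta>_def)
    qed
    ultimately have low: "ennreal (c * ln (d / 2 / \<delta>) powr (q / n)) \<le>
         path_modulus q (ball 0 1) (joining_paths E F (ball 0 1))"
      unfolding n_def using \<delta> by (intro mod) auto
    define N where "N = L1_norm Q"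
    have N: "(\<integral>\<^sup>+ y. Q y \<partial>lebesgue) = ennreal N" "N \<ge> 0"
      using Q(2) by (auto simp: N_def L1_norm_def)
    define \<epsilon> where "\<epsilon> = norm (f x - f y)"
    have \<epsilon>: "\<epsilon> > 0" using False by (simp add: \<epsilon>_def)
    have "ennreal (c * ln (d / 2 / \<delta>) powr (q / n)) \<le> ennreal (\<epsilon> powr (-q) * N)"
      using order_trans[OF low up] N \<epsilon> by (simp add: ennreal_mult \<epsilon>_def)
    then have le: "c * ln (d / 2 / \<delta>) powr (q / n) \<le> \<epsilon> powr (-q) * N"
      using N by (simp add: ennreal_le_iff)
    define u where "u = d / (2 * \<delta>)"
    have u: "u \<ge> 2" using \<delta> by (simp add: u_def field_simps)
    define l where "l = ln (1 + u)"
    have l: "l > 0" using u by (simp add: l_def)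
    \<comment> \<open>The hypothesis |x - y| <= d/4 means u >= 2, so 1 + u <= u^2 and ln (1 + u) is
      at most twice ln u. The loss appears as 2^(1/n) in \<open>C\<close>.\<close>
    have "2 * u \<le> u * u" using u by (intro mult_right_mono) auto
    then have "1 + u \<le> u ^ 2" using u unfolding power2_eq_square by linarith
    then have "l \<le> ln (u ^ 2)" unfolding l_def using u by simp
    then have "l / 2 \<le> ln (d / 2 / \<delta>)" using u by (simp add: ln_realpow u_def)
    then have "c * (l / 2) powr (q / n) \<le> c * ln (d / 2 / \<delta>) powr (q / n)"
      using l c n by (intro mult_left_mono powr_mono2) auto
    with le have "c * (l / 2) powr (q / n) \<le> \<epsilon> powr (-q) * N" by linarith
    then have "\<epsilon> powr q * (c * (l / 2) powr (q / n)) \<le> \<epsilon> powr q * (\<epsilon> powr (-q) * N)"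
      by (rule mult_left_mono) simp
    also have "\<dots> = N" using \<epsilon> by (simp add: mult.assoc[symmetric] powr_add[symmetric])
    finally have "(\<epsilon> powr q * (c * (l / 2) powr (q / n))) powr (1 / q) \<le> N powr (1 / q)"
      using c n by (intro powr_mono2) auto
    then have "\<epsilon> * (c powr (1 / q) * (l / 2) powr (1 / n)) \<le> N powr (1 / q)"
      using \<epsilon> c n l by (simp add: powr_mult powr_powr)
    then have "\<epsilon> \<le> N powr (1 / q) / (c powr (1 / q) * (l / 2) powr (1 / n))"
      using c l by (simp add: pos_le_divide_eq)
    also have "\<dots> = C * (N powr (1 / q) / l powr (1 / n))"
    proof -
      have "(l / 2) powr (1 / n) = l powr (1 / n) / 2 powr (1 / n)" by (rule powr_divide)
      then show ?thesis by (simp only: C_def powr_minus_divide) simp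
    qed
    finally show ?thesis by (simp add: \<epsilon>_def N_def l_def u_def d_def \<delta>_def)
  qed
  then show thesis using that[OF C] unfolding n_def by blast
qed

section \<open>Oscillation of the mapping\<close>

context
  fixes f :: "'a::real_normed_vector \<Rightarrow> 'b::real_normed_vector" and A :: real
  assumes A: "0 \<le> A"
    and loc: "\<And>x y. norm x < 1 \<Longrightarrow> dist x y \<le> (1 - norm x) / 4 \<Longrightarrow> norm (f x - f y) \<le> A"
begin

lemma oscillation_along_segment:
  assumes "0 < \<delta>" "norm x \<le> 1 - \<delta>" "norm y \<le> 1 - \<delta>" "dist x y \<le> real m * (\<delta> / 4)"
  shows "norm (f x - f y) \<le> real m * A"
  using assms(3,4)
proof (induction m arbitrary: y)
  case (Suc m)
  define a where "a = 1 / (real m + 1)"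
  \<comment> \<open>The last of m + 1 equal steps from \<open>x\<close> to \<open>y\<close> starts
    at \<open>w\<close>. Convexity of the ball of radius 1 - delta keeps it deep enough for the
    local bound.\<close>
  define w where "w = (1 - a) *\<^sub>R y + a *\<^sub>R x"
  have a: "0 < a" "a \<le> 1" by (auto simp: a_def)
  have "norm w \<le> (1 - a) * (1 - \<delta>) + a * (1 - \<delta>)"
    unfolding w_def using a Suc.prems assms(2)
    by (intro norm_triangle_le add_mono) (auto intro!: mult_left_mono)
  then have w: "norm w \<le> 1 - \<delta>" by (simp add: algebra_simps)
  have "x - w = (1 - a) *\<^sub>R (x - y)" by (simp add: w_def algebra_simps)
  then have "dist x w = (1 - a) * dist x y" using a by (simp add: dist_norm)
  also have "\<dots> \<le> (1 - a) * (real (Suc m) * (\<delta> / 4))" using a Suc.prems by (intro mult_left_mono) auto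
  also have "\<dots> = real m * (\<delta> / 4)" by (simp add: a_def field_simps)
  finally have 1: "norm (f x - f w) \<le> real m * A" using Suc.IH[OF w] by simp
  have "w - y = a *\<^sub>R (x - y)" by (simp add: w_def algebra_simps)
  then have "dist w y = a * dist x y" using a by (simp add: dist_norm)
  also have "\<dots> \<le> a * (real (Suc m) * (\<delta> / 4))" using a Suc.prems by (intro mult_left_mono) auto
  also have "\<dots> = \<delta> / 4" by (simp add: a_def field_simps)
  finally have 2: "norm (f w - f y) \<le> A" using w assms(1) by (intro loc) auto
  have "norm (f x - f y) \<le> norm (f x - f w) + norm (f w - f y)"
    using norm_triangle_ineq[of "f x - f w" "f w - f y"] by simp
  then show ?case using 1 2 by (simp add: algebra_simps)
qed simp

text \<open>Doubling the distance to the unit sphere costs four steps at each end and halves the relative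
  distance, so the oscillation grows only logarithmically with \<^term>\<open>dist x y / \<delta>\<close>.\<close>

lemma oscillation_log_chain:
  assumes "0 < \<delta>" "norm x \<le> 1 - \<delta>" "norm y \<le> 1 - \<delta>" "dist x y \<le> 2 ^ k * (\<delta> / 4)"
  shows "norm (f x - f y) \<le> 8 * (real k + 1) * A"
  using assms
proof (induction k arbitrary: x y \<delta>)
  case 0
  then have "norm (f x - f y) \<le> real 1 * A" by (intro oscillation_along_segment[of \<delta>]) auto
  then show ?case using A by simp
next
  case (Suc k)
  show ?case
  proof (cases "2 * \<delta> \<le> 1")
    case False
    \<comment> \<open>Both norms are at most 1 - delta with delta > 1/2, so the distance is below 2
      delta, which is eight steps of length delta/4.\<close>
    have "dist x y \<le> norm x + norm y" by (simp add: dist_norm norm_triangle_ineq4)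
    then have "norm (f x - f y) \<le> real 8 * A"
      using Suc.prems False by (intro oscillation_along_segment[of \<delta>]) auto
    also have "\<dots> \<le> 8 * (real (Suc k) + 1) * A" using A by (intro mult_right_mono) auto
    finally show ?thesis .
  next
    case True
    \<comment> \<open>Scaling by \<open>a\<close> takes the ball of radius 1 - delta onto the one of
      radius 1 - 2 delta and moves each point by at most delta, that is four steps of length
      delta/4.\<close>
    define a where "a = (1 - 2 * \<delta>) / (1 - \<delta>)"
    have a: "0 \<le> a" "a \<le> 1" and a1: "a * (1 - \<delta>) = 1 - 2 * \<delta>" "(1 - a) * (1 - \<delta>) = \<delta>"
      using True Suc.prems(1) by (auto simp: a_def field_simps)
    have step: "norm (f u - f (a *\<^sub>R u)) \<le> 4 * A" and inner: "norm (a *\<^sub>R u) \<le> 1 - 2 * \<delta>"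
      if u: "norm u \<le> 1 - \<delta>" for u
    proof -
      show *: "norm (a *\<^sub>R u) \<le> 1 - 2 * \<delta>"
        using mult_left_mono[OF u a(1)] a a1 by simp
      have "u - a *\<^sub>R u = (1 - a) *\<^sub>R u" by (simp add: algebra_simps)
      then have "dist u (a *\<^sub>R u) = (1 - a) * norm u" using a by (simp add: dist_norm)
      also have "\<dots> \<le> real 4 * (\<delta> / 4)" using mult_left_mono[OF u, of "1 - a"] a a1 by simp
      finally show "norm (f u - f (a *\<^sub>R u)) \<le> 4 * A"
        using oscillation_along_segment[of \<delta> u "a *\<^sub>R u" 4] Suc.prems(1) u * by simp
    qed
    have "dist (a *\<^sub>R x) (a *\<^sub>R y) = a * dist x y"
      using a by (simp add: dist_norm scaleR_diff_right[symmetric])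
    also have "\<dots> \<le> 1 * dist x y" using a by (intro mult_right_mono) auto
    also have "\<dots> \<le> 2 ^ k * (2 * \<delta> / 4)" using Suc.prems by (simp add: mult_ac)
    finally have "norm (f (a *\<^sub>R x) - f (a *\<^sub>R y)) \<le> 8 * (real k + 1) * A"
      using Suc.prems inner by (intro Suc.IH[of "2 * \<delta>"]) auto
    moreover have "norm (f x - f y) \<le> norm (f x - f (a *\<^sub>R x)) + norm (f (a *\<^sub>R x) - f (a *\<^sub>R y)) + norm (f y - f (a *\<^sub>R y))"
      using norm_triangle_ineq[of "f x - f (a *\<^sub>R x)" "f (a *\<^sub>R x) - f (a *\<^sub>R y)"]
        norm_triangle_ineq4[of "f x - f (a *\<^sub>R y)" "f y - f (a *\<^sub>R y)"] by simp
    ultimately show ?thesis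
      using step[OF Suc.prems(2)] step[OF Suc.prems(3)] by (simp add: algebra_simps)
  qed
qed

end

lemma root_two_minus_one_bounds:
  fixes n :: nat
  assumes "n \<ge> 1"
  shows "0 < (2::real) powr (1 / n) - 1" "(2::real) powr (1 / n) - 1 \<le> 1"
proof -
  have "(2::real) powr 0 < 2 powr (1 / n)" using assms by (intro powr_less_mono) auto
  then show "0 < (2::real) powr (1 / n) - 1" by simp
  have "(2::real) powr (1 / n) \<le> 2 powr 1" using assms by (intro powr_mono) auto
  then show "(2::real) powr (1 / n) - 1 \<le> 1" by simp
qed

text \<open>Bernoulli's inequality for 1 + h = 2^(1/n) bounds the number of levels by a power: (k+1)
  h <= 1 + k h <= 2^(k/n), and 2^k <= 2X when k is the rounded-up binary logarithm of X.\<close>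

lemma log_chain_le_power:
  fixes X h :: real and n :: nat
  assumes n: "n \<ge> 1" and X: "1 \<le> X" and h: "h = 2 powr (1 / n) - 1"
  obtains k where "X \<le> 2 ^ k" "real k + 1 \<le> (2 * X) powr (1 / n) / h"
proof -
  have h1: "0 < h" "h \<le> 1" unfolding h using root_two_minus_one_bounds[OF n] by auto
  define k where "k = nat \<lceil>log 2 X\<rceil>"
  have lg: "0 \<le> log 2 X" using X by simp
  have k: "log 2 X \<le> real k" "real k \<le> log 2 X + 1" using lg unfolding k_def by linarith+
  have "X = 2 powr (log 2 X)" using X by simp
  also have "\<dots> \<le> 2 powr (real k)" using k by (intro powr_mono) auto
  finally have Xk: "X \<le> 2 ^ k" by (simp add: powr_realpow)
  have "(2::real) ^ k = 2 powr real k" by (simp add: powr_realpow)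
  also have "\<dots> \<le> 2 powr (log 2 X + 1)" using k by (intro powr_mono) auto
  also have "\<dots> = 2 * X" using X by (simp add: powr_add)
  finally have kX: "2 ^ k \<le> 2 * X" .
  have "(real k + 1) * h \<le> 1 + real k * h" using h1 by (simp add: algebra_simps)
  also have "\<dots> \<le> (1 + h) ^ k" using Bernoulli_inequality[of h k] h1 by simp
  also have "\<dots> = (2 ^ k) powr (1 / n)" by (simp add: h powr_realpow[symmetric] powr_powr mult.commute)
  also have "\<dots> \<le> (2 * X) powr (1 / n)" using kX by (intro powr_mono2) auto
  finally show thesis using that[OF Xk] h1 by (simp add: pos_le_divide_eq)
qed

theorem theorem1p1:
  fixes q :: real
  assumes "CARD('n::finite) \<ge> 2" and "real CARD('n) \<le> q"
  shows "\<exists>C>0. \<forall>(Q :: real^'n \<Rightarrow> ennreal) (f :: real^'n \<Rightarrow> real^'n) (K :: (real^'n) set).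
    Q \<in> borel_measurable lebesgue \<and> (\<integral>\<^sup>+ y. Q y \<partial>lebesgue) < \<infinity> \<and>
    f \<in> inverse_Poletsky q Q (ball 0 1) \<and>
    compact K \<and> K \<noteq> {} \<and> K \<subseteq> ball 0 1 \<longrightarrow>
    (\<forall>x\<in>K. \<forall>y\<in>K.
       norm (f x - f y) \<le>
         (if x = y then 0
          else C * (L1_norm Q powr (1 / q) /
            ln (1 + setdist K (frontier (ball 0 1)) / (2 * norm (x - y))) powr (1 / real CARD('n)))))"
proof -
  define n where "n = CARD('n)"
  have n: "n \<ge> 1" using assms by (simp add: n_def)
  obtain C1 where C1: "0 < C1" and loc:
    "\<And>Q f (x::real^'n) y. Q \<in> borel_measurable lebesgue \<Longrightarrow> (\<integral>\<^sup>+ y. Q y \<partial>lebesgue) < \<infinity> \<Longrightarrow>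
       f \<in> inverse_Poletsky q Q (ball 0 1) \<Longrightarrow> x \<in> ball 0 1 \<Longrightarrow> x \<noteq> y \<Longrightarrow>
       dist x y \<le> (1 - norm x) / 4 \<Longrightarrow>
       norm (f x - f y) \<le> C1 * (L1_norm Q powr (1 / q) /
         ln (1 + (1 - norm x) / (2 * dist x y)) powr (1 / n))"
    using inverse_Poletsky_local_estimate[where 'a="real^'n", of q] assms
    unfolding n_def by (auto simp: DIM_cart)
  define h where "h = (2::real) powr (1 / n) - 1"
  \<comment> \<open>The factor 8/h comes from the chaining with its Bernoulli bound, and 4^(1/n)
    from writing 2X = 4 (X/2). Since \<open>C\<close> is at least \<open>C1\<close>, it also covers
    close points.\<close>
  define C where "C = 8 * C1 / h * 4 powr (1 / n)"
  have h: "0 < h" "h \<le> 1" unfolding h_def using root_two_minus_one_bounds[OF n] by auto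
  have C: "0 < C" using C1 h by (simp add: C_def)
  have "1 * C1 \<le> (8 / h * 4 powr (1 / n)) * C1"
    using C1 h ge_one_powr_ge_zero[of 4 "1 / n"] mult_mono[of 1 "8 / h" 1 "4 powr (1 / n)"]
    by (intro mult_right_mono) auto
  then have C1C: "C1 \<le> C" by (simp add: C_def mult_ac)
  have "norm (f x - f y) \<le> C * (L1_norm Q powr (1 / q) /
          ln (1 + setdist K (frontier (ball 0 1)) / (2 * norm (x - y))) powr (1 / n))"
    if Q: "Q \<in> borel_measurable lebesgue" "(\<integral>\<^sup>+ y. Q y \<partial>lebesgue) < \<infinity>"
      and f: "f \<in> inverse_Poletsky q Q (ball 0 1)"
      and K: "compact K" "K \<subseteq> ball 0 1" and x: "x \<in> K" and y: "y \<in> K" and xy: "x \<noteq> y"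
    for Q and f :: "real^'n \<Rightarrow> real^'n" and K x y
  proof -
    define r where "r = setdist K (frontier (ball (0::real^'n) 1))"
    have "K \<inter> sphere 0 1 = {}" using K(2) by auto
    moreover have "sphere (0::real^'n) 1 \<noteq> {}" by simp
    ultimately have "r \<noteq> 0"
      using setdist_eq_0_compact_closed[OF K(1) closed_sphere, of 0 1] x by (auto simp: r_def)
    then have r: "r > 0" 
      using setdist_pos_le[of K "frontier (ball (0::real^'n) 1)"] unfolding r_def by linarith
    have depth: "r \<le> 1 - norm u" if u: "u \<in> K" for u
    proof -
      \<comment> \<open>The radial projection of \<open>u\<close> realises the distance 1 - |u| to
        the sphere; at the origin any unit vector does.\<close>
      obtain s where s: "s \<in> sphere (0::real^'n) 1" "dist u s \<le> 1 - norm u"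
      proof (cases "u = 0")
        case True
        then show thesis using that[of "axis undefined 1"] by (simp add: norm_axis_1)
      next
        case False
        have "u - u /\<^sub>R norm u = (1 - 1 / norm u) *\<^sub>R u" by (simp add: algebra_simps divide_inverse)
        then have "dist u (u /\<^sub>R norm u) = \<bar>1 - 1 / norm u\<bar> * norm u" by (simp add: dist_norm)
        also have "\<dots> = 1 - norm u" using K(2) u False by (auto simp: abs_if field_simps)
        finally show thesis using that[of "u /\<^sub>R norm u"] False by simp
      qed
      have "r \<le> dist u s" unfolding r_def using u s by (intro setdist_le_dist) auto
      then show ?thesis using s by simp
    qed
    define N where "N = L1_norm Q powr (1 / q)"
    have N: "N \<ge> 0" by (simp add: N_def)
    define L where "L = dist x y"
    have L: "L > 0" using xy by (simp add: L_def)
    define l where "l = ln (1 + r / (2 * L))"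
    have l: "0 < l" unfolding l_def using r L by (intro ln_gt_zero) simp
    have "norm (f x - f y) \<le> C * (N / l powr (1 / n))"
    proof (cases "L \<le> r / 4")
      case True
      have "norm (f x - f y) \<le> C1 * (N / ln (1 + (1 - norm x) / (2 * L)) powr (1 / n))"
        unfolding N_def L_def
        using True depth[OF x] x K by (intro loc Q f xy) (auto simp: L_def)
      also have "\<dots> \<le> C1 * (N / l powr (1 / n))"
      proof (intro mult_left_mono divide_left_mono)
        have "l \<le> ln (1 + (1 - norm x) / (2 * L))"
          unfolding l_def using depth[OF x] r L by (auto intro!: add_left_mono divide_right_mono simp: add_pos_nonneg)
        then show "l powr (1 / n) \<le> ln (1 + (1 - norm x) / (2 * L)) powr (1 / n)"
          using l by (intro powr_mono2) auto
        show "0 < ln (1 + (1 - norm x) / (2 * L)) powr (1 / n) * l powr (1 / n)"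
          using l \<open>l \<le> _\<close> by simp
      qed (use N C1 in auto)
      also have "\<dots> \<le> C * (N / l powr (1 / n))" using C1C N by (intro mult_right_mono) auto
      finally show ?thesis .
    next
      case False
      have osc: "norm (f u - f w) \<le> C1 * N" if "norm u < 1" "dist u w \<le> (1 - norm u) / 4" for u w
      proof (cases "u = w")
        case True
        then show ?thesis using C1 N by simp
      next
        case neq: False
        have "2 \<le> (1 - norm u) / (2 * dist u w)" using that neq by (simp add: field_simps)
        then have "exp 1 \<le> 1 + (1 - norm u) / (2 * dist u w)" using exp_le by linarith
        then have "1 \<le> ln (1 + (1 - norm u) / (2 * dist u w))"
          by (subst ln_ge_iff) (auto intro: less_le_trans[OF exp_gt_zero])
        then have "N / ln (1 + (1 - norm u) / (2 * dist u w)) powr (1 / n) \<le> N / 1"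
          using N by (intro divide_left_mono ge_one_powr_ge_zero) auto
        then have "C1 * (N / ln (1 + (1 - norm u) / (2 * dist u w)) powr (1 / n)) \<le> C1 * N"
          using C1 by (intro mult_left_mono) auto
        moreover have "norm (f u - f w) \<le> C1 * (N / ln (1 + (1 - norm u) / (2 * dist u w)) powr (1 / n))"
          unfolding N_def using that by (intro loc Q f neq) auto
        ultimately show ?thesis by linarith
      qed
      \<comment> \<open>This is |x - y| in units of the step length r/4; it exceeds 1 exactly
        because the points are not close.\<close>
      define X where "X = 4 * L / r"
      have X: "1 \<le> X" using False r by (simp add: X_def field_simps)
      obtain k where k: "X \<le> 2 ^ k" "real k + 1 \<le> (2 * X) powr (1 / n) / h"
        using log_chain_le_power[OF n X h_def] by blast
      have "norm (f x - f y) \<le> 8 * (real k + 1) * (C1 * N)"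
      proof (rule oscillation_log_chain[OF _ osc r])
        have "L = X * (r / 4)" using r by (simp add: X_def)
        then show "dist x y \<le> 2 ^ k * (r / 4)" using k(1) r by (simp add: L_def)
      qed (use depth[OF x] depth[OF y] C1 N in auto)
      also have "\<dots> \<le> 8 * ((2 * X) powr (1 / n) / h) * (C1 * N)"
        using k(2) C1 N by (intro mult_right_mono mult_left_mono) auto
      also have "\<dots> = C * N * (X / 2) powr (1 / n)"
      proof -
        have "(2 * X) powr (1 / n) = (4 * (X / 2)) powr (1 / n)" by simp
        also have "\<dots> = 4 powr (1 / n) * (X / 2) powr (1 / n)" by (rule powr_mult)
        finally show ?thesis by (simp add: C_def mult_ac)
      qed
      also have "\<dots> \<le> C * N * (1 / l powr (1 / n))"
      proof (intro mult_left_mono)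
        \<comment> \<open>By ln (1 + v) <= v, the logarithm in the claim is at most 2/X, so
          (X/2)^(1/n) from the chaining is at most 1/l^(1/n).\<close>
        have "l \<le> r / (2 * L)" unfolding l_def using r L by (intro ln_add_one_self_le_self) auto
        also have "\<dots> = 2 / X" using r L by (simp add: X_def)
        finally have "l powr (1 / n) \<le> (2 / X) powr (1 / n)" using l by (intro powr_mono2) auto
        also have "\<dots> = 1 / (X / 2) powr (1 / n)" using X by (simp add: powr_divide)
        finally show "(X / 2) powr (1 / n) \<le> 1 / l powr (1 / n)"
          using X l by (simp add: field_simps)
      qed (use C N in auto)
      finally show ?thesis by simp
    qed
    then show ?thesis by (simp add: N_def l_def L_def r_def dist_norm)
  qed
  then show ?thesis using C unfolding n_def by (intro exI[of _ C]) auto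
qed

end
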